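(* Let $k\ge 1$ and $t\ge 3$ be integers, $\varepsilon>0$ a constant, and let $P:\{0,1\}^k\to\{0,1\}$ be $(t-1)$-wise uniform supporting. Let $\mathcal{I}$ be a random instance of $\mathrm{CSP}(P)$ with $n$ variables and $m\le n^{t/2-\varepsilon}$ constraints. Then there is $r=\Omega(n^{\varepsilon/(t-2)})$ such that, with high probability, $N_+^r(L_{\mathcal{I}})$ is nonempty (the $r$-round Lovász–Schrijver$_+$ relaxation of $\mathcal{I}$ has value $1$).
   Context: $P$ is $s$-wise uniform supporting if there is a distribution $\mu$ on $\{0,1\}^k$ supported on $P^{-1}(1)$ such that $\Pr_{z\sim\mu}[z_T=\alpha]=2^{-|T|}$ for all $T\subseteq[k]$ with $1\le|T|\le s$ and all $\alpha\in\{0,1\}^T$. An instance of $\mathrm{CSP}(P)$ on $x_1,\dots,x_n\in\{0,1\}$ is a multiset of constraints $(c,S)$, $c\in\{0,1\}^k$, $S\in[n]^k$, meaning $P(x_S\oplus c)=1$. A random instance has its $m$ constraints chosen independently and uniformly among all $2^kn^k$ pairs. "With high probability" means with probability $1-o(1)$ as $n\to\infty$ with $k,t,\varepsilon,P$ fixed. For $a\in\mathbb{R}$ and $b\in\{0,1\}$ let $a^{(b)}=a$ if $b=0$ and $1-a$ if $b=1$. Let $F=P^{-1}(0)$. Then $L_{\mathcal{I}}$ is the set of linear inequalities $\sum_{i=1}^k x_{S_i}^{(c_i\oplus f_i)}\ge 1$ for $(c,S)\in\mathcal{I}$, $f\in F$; let $K\subseteq\mathbb{R}^n$ be the polytope they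 define, and $N_+^r(L_{\mathcal{I}})=N_+^r(K)$. For a convex set $K\subseteq\mathbb{R}^n$ let $\widetilde K=\{(\lambda,\lambda x):\lambda>0,x\in K\}\subseteq\mathbb{R}^{n+1}$ (coordinates indexed $0,1,\dots,n$). $N_+(\widetilde K)$ is the set of $y\in\mathbb{R}^{n+1}$ for which there is a symmetric positive semidefinite $(n+1)\times(n+1)$ matrix $Y$ with $Y_{ii}=Y_{i0}=y_i$ for all $i$, and, writing $Y_i$ for the $i$-th column, $Y_i\in\widetilde K$ and $Y_0-Y_i\in\widetilde K$ for all $i\in[n]$. $N_+(K)=N_+(\widetilde K)\cap\{y_0=1\}$ (identified with a subset of $\mathbb{R}^n$), and $N_+^r(K)=N_+(N_+^{r-1}(K))$, $N_+^0(K)=K$.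
   Formalization: The cone over K is taken with λ ≥ 0 (apex included, the standard Lovász–Schrijver definition) instead of λ > 0; with λ > 0, N_+^r(K) is empty for every K once r ≥ 2 and n ≥ 1, so the claim would be false. *)

theory Defs
  imports
    "HOL-Probability.Probability"
    "HOL-Library.Landau_Symbols"
    "Jordan_Normal_Form.Matrix"
begin

text \<open>
  The arity \<open>k\<close> is the cardinality of a finite type \<open>'k\<close>, and \<open>{0,1}\<^sup>k\<close> is \<open>'k \<Rightarrow> bool\<close>.
  The number of variables \<open>n\<close> varies, so \<open>\<real>\<^sup>n\<close> is \<open>carrier_vec n\<close>; the variables \<open>x\<^sub>1, \<dots>, x\<^sub>n\<close>
  have the indices \<open>0, \<dots>, n - 1\<close>.
\<close>

type_synonym 'k constraint = "('k \<Rightarrow> bool) \<times> ('k \<Rightarrow> nat)"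

definition uniform_supporting :: "nat \<Rightarrow> (('k::finite \<Rightarrow> bool) \<Rightarrow> bool) \<Rightarrow> bool" where
  "uniform_supporting s P \<longleftrightarrow>
     (\<exists>\<mu> :: ('k \<Rightarrow> bool) pmf. set_pmf \<mu> \<subseteq> {z. P z} \<and>
        (\<forall>T \<alpha>. 1 \<le> card T \<and> card T \<le> s \<longrightarrow>
           measure_pmf.prob \<mu> {z. \<forall>i\<in>T. z i = \<alpha> i} = (1 / 2) ^ card T))"

definition constraints :: "nat \<Rightarrow> 'k::finite constraint set" where
  "constraints n = UNIV \<times> {S. \<forall>i. S i < n}"

definition random_instance :: "nat \<Rightarrow> nat \<Rightarrow> 'k::finite constraint multiset pmf" where
  "random_instance n m = map_pmf mset (replicate_pmf m (pmf_of_set (constraints n)))"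

definition literal :: "real \<Rightarrow> bool \<Rightarrow> real" where
  "literal a b = (if b then 1 - a else a)"

text \<open>Exclusive or is \<open>\<noteq>\<close> on \<open>bool\<close>.\<close>

definition csp_polytope ::
  "nat \<Rightarrow> (('k::finite \<Rightarrow> bool) \<Rightarrow> bool) \<Rightarrow> 'k constraint multiset \<Rightarrow> real vec set" where
  "csp_polytope n P I =
     {x \<in> carrier_vec n. \<forall>(c, S) \<in> set_mset I. \<forall>f. \<not> P f \<longrightarrow>
        (\<Sum>i\<in>UNIV. literal (x $ S i) (c i \<noteq> f i)) \<ge> 1}"

definition psd_mat :: "nat \<Rightarrow> real mat \<Rightarrow> bool" where
  "psd_mat d Y \<longleftrightarrow> Y \<in> carrier_mat d d \<and> transpose_mat Y = Y \<and>
     (\<forall>v \<in> carrier_vec d. v \<bullet> (Y *\<^sub>v v) \<ge> 0)"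

text \<open>
  The apex \<open>\<lambda> = 0\<close> belongs to the cone, as in the usual Lovasz-Schrijver definition. Without it,
  two rounds would always give the empty set for \<open>n \<ge> 1\<close>: a point of \<open>N\<^sub>+(K)\<close> would have all its
  coordinates strictly between 0 and 1, whereas the normalised column \<open>Y\<^sub>i / Y\<^sub>0\<^sub>i\<close> has
  \<open>i\<close>-th coordinate 1.
\<close>

definition homog_cone :: "real vec set \<Rightarrow> real vec set" where
  "homog_cone K = {vCons l (l \<cdot>\<^sub>v x) | l x. l \<ge> 0 \<and> x \<in> K}"

definition N_plus_cone :: "nat \<Rightarrow> real vec set \<Rightarrow> real vec set" where
  "N_plus_cone n C =
     {y \<in> carrier_vec (n + 1). \<exists>Y. psd_mat (n + 1) Y \<and>
        (\<forall>i \<in> {0..n}. Y $$ (i, i) = y $ i \<and> Y $$ (i, 0) = y $ i) \<and>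
        (\<forall>i \<in> {1..n}. col Y i \<in> C \<and> col Y 0 - col Y i \<in> C)}"

definition N_plus :: "nat \<Rightarrow> real vec set \<Rightarrow> real vec set" where
  "N_plus n K = {x \<in> carrier_vec n. vCons 1 x \<in> N_plus_cone n (homog_cone K)}"

end

theory Submission
  imports Defs
begin

text \<open>
  Give a set \<open>E\<close> of constraints, relative to a set \<open>C\<close> of variables that are already fixed, the
  surplus \<open>2 |V - C| + |V \<inter> C| - (2k - t) |E|\<close>, where \<open>V\<close> is the set of variables of \<open>E\<close>. It is
  submodular in \<open>E\<close>. If all nonempty subsets of \<open>E\<close> have positive surplus, then some constraint of \<open>E\<close>
  has at most \<open>t - 1\<close> positions that are fixed or shared, so by \<open>(t - 1)\<close>-wise uniformity it
  integrates out of the product of the local distributions. Hence that product has total mass 1 for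
  every assignment of \<open>C\<close>, and it has uniform marginals if the surpluses are at least 2.

  In a random instance all small sets \<open>E\<close> have surplus at least \<open>d |E|\<close> for a constant \<open>d > 0\<close>.
  First fix all variables of the small sets of surplus 1: afterwards all remaining small sets
  have surplus at least 2. From then on the current point is 0 or 1 on the fixed variables and 1/2
  elsewhere. The sets of surplus exactly 2 fall into clusters with disjoint sets of unfixed variables,
  and the protection matrix is the second moment matrix of the product over the clusters of the local
  distributions, so its covariance part is block diagonal and positive semidefinite. Conditioning on
  one variable and then sampling its cluster leaves all other variables at 1/2, restores surplus at
  least 2, and uses up only a bounded part of the slack \<open>d |E|\<close>, so this can be repeated \<open>r\<close> times.
\<close>

section \<open>Surplus of constraint sets\<close>

text \<open>A set of constraints is a set of positions in the instance, so equal constraints at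
  different positions are counted separately.\<close>

definition vars :: "(nat \<Rightarrow> 'k::finite constraint) \<Rightarrow> nat set \<Rightarrow> nat set" where
  "vars cs E = (\<Union>e\<in>E. range (snd (cs e)))"

text \<open>The weights 2 of a free and 1 of a fixed variable arise as \<open>|V| + |V - C|\<close>.
  The type is \<open>int\<close> because the difference may be negative.\<close>

definition surplus :: "(nat \<Rightarrow> 'k::finite constraint) \<Rightarrow> nat \<Rightarrow> nat set \<Rightarrow> nat set \<Rightarrow> int" where
  "surplus cs t C E = int (card (vars cs E)) + int (card (vars cs E - C))
     - (2 * int CARD('k) - int t) * int (card E)"

lemma vars_empty [simp]: "vars cs {} = {}"
  by (simp add: vars_def)

lemma vars_Un: "vars cs (A \<union> B) = vars cs A \<union> vars cs B"
  by (auto simp: vars_def)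

lemma vars_mono: "A \<subseteq> B \<Longrightarrow> vars cs A \<subseteq> vars cs B"
  by (auto simp: vars_def)

lemma finite_vars [simp]: "finite E \<Longrightarrow> finite (vars cs E)"
  by (simp add: vars_def)

lemma scope_in_vars: "e \<in> E \<Longrightarrow> snd (cs e) q \<in> vars cs E"
  by (auto simp: vars_def)

lemma surplus_empty [simp]: "surplus cs t C {} = 0"
  by (simp add: surplus_def)

text \<open>Coverage functions \<open>\<lambda>E. card (vars cs E - X)\<close> are submodular, since
  \<open>vars cs (A \<inter> B)\<close> lies in \<open>vars cs A \<inter> vars cs B\<close>. The
  surplus adds two of them, for \<open>X = {}\<close> and \<open>X = C\<close>, and subtracts a
  multiple of the modular function \<open>card\<close>.\<close>

lemma surplus_submodular:
  assumes "finite A" "finite B"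
  shows "surplus cs t C (A \<union> B) + surplus cs t C (A \<inter> B) \<le> surplus cs t C A + surplus cs t C B"
proof -
  have mod: "card (vars cs (A \<union> B) - X) + card (vars cs (A \<inter> B) - X)
      \<le> card (vars cs A - X) + card (vars cs B - X)" for X
  proof -
    have "card (vars cs (A \<inter> B) - X) \<le> card ((vars cs A - X) \<inter> (vars cs B - X))"
      using assms vars_mono[of "A \<inter> B" A cs] vars_mono[of "A \<inter> B" B cs] by (intro card_mono) auto
    moreover have "card (vars cs A - X) + card (vars cs B - X) =
        card (vars cs (A \<union> B) - X) + card ((vars cs A - X) \<inter> (vars cs B - X))"
      using assms card_Un_Int[of "vars cs A - X" "vars cs B - X"] by (simp add: vars_Un Un_Diff)
    ultimately show ?thesis by linarith
  qed
  have c: "int (card A) + int (card B) = int (card (A \<union> B)) + int (card (A \<inter> B))"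
    using card_Un_Int[OF assms] by linarith
  have "(2 * int CARD('a) - int t) * int (card (A \<union> B)) + (2 * int CARD('a) - int t) * int (card (A \<inter> B))
     = (2 * int CARD('a) - int t) * int (card A) + (2 * int CARD('a) - int t) * int (card B)"
    by (metis c distrib_left)
  with mod[of C] mod[of "{}"] show ?thesis
    unfolding surplus_def by simp
qed

text \<open>Inclusion-exclusion for the variables: a shared fixed variable costs one unit, a shared
  free variable two.\<close>

lemma surplus_Un_disjoint:
  assumes "finite A" "finite B" "A \<inter> B = {}"
  shows "surplus cs t C (A \<union> B) = surplus cs t C A + surplus cs t C B
    - int (card (vars cs A \<inter> vars cs B)) - int (card (vars cs A \<inter> vars cs B - C))"
proof -
  have 1: "card (vars cs A - X) + card (vars cs B - X) =
        card (vars cs (A \<union> B) - X) + card (vars cs A \<inter> vars cs B - X)" for X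
  proof -
    have "(vars cs A - X) \<inter> (vars cs B - X) = vars cs A \<inter> vars cs B - X" by auto
    thus ?thesis using assms card_Un_Int[of "vars cs A - X" "vars cs B - X"] 
      by (simp add: vars_Un Un_Diff)
  qed
  have "int (card (A \<union> B)) = int (card A) + int (card B)"
    using assms by (simp add: card_Un_disjoint)
  thus ?thesis using 1[of C] 1[of "{}"]
    by (simp add: surplus_def algebra_simps)
qed

lemma surplus_fix_more:
  assumes "finite E"
  shows "surplus cs t (C \<union> X) E = surplus cs t C E - int (card (vars cs E \<inter> X - C))"
proof -
  have "card (vars cs E - C) = card (vars cs E - (C \<union> X)) + card (vars cs E \<inter> X - C)"
    using assms by (subst card_Un_disjoint[symmetric]) (auto intro: arg_cong[where f=card])
  thus ?thesis by (simp add: surplus_def)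
qed

section \<open>Local distributions\<close>

text \<open>The subcube through \<open>\<rho>\<close> with free coordinates \<open>W\<close>.
  Pinning the other coordinates keeps it finite for finite \<open>W\<close>, although assignments
  are functions on all of \<open>nat\<close>.\<close>

definition agree :: "nat set \<Rightarrow> (nat \<Rightarrow> bool) \<Rightarrow> (nat \<Rightarrow> bool) set" where
  "agree W \<rho> = {z. \<forall>v. v \<notin> W \<longrightarrow> z v = \<rho> v}"

lemma agree_empty [simp]: "agree {} \<rho> = {\<rho>}"
  by (auto simp: agree_def)

lemma agree_singleton: "agree {x} y = {y(x := True), y(x := False)}"
proof (intro Set.set_eqI iffI)
  fix z assume z: "z \<in> agree {x} y"
  have "z = y(x := z x)" using z by (simp add: agree_def fun_eq_iff)
  thus "z \<in> {y(x := True), y(x := False)}" by (cases "z x") simp_all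
qed (auto simp: agree_def)

lemma finite_agree [simp]:
  assumes "finite W"
  shows "finite (agree W \<rho>)"
proof -
  have "agree W \<rho> \<subseteq> (\<lambda>A v. if v \<in> W then v \<in> A else \<rho> v) ` Pow W"
  proof
    fix z assume "z \<in> agree W \<rho>"
    hence "z = (\<lambda>v. if v \<in> W then v \<in> {v\<in>W. z v} else \<rho> v)"
      by (auto simp: agree_def)
    thus "z \<in> (\<lambda>A v. if v \<in> W then v \<in> A else \<rho> v) ` Pow W" by blast
  qed
  thus ?thesis using assms finite_subset by blast
qed

lemma sum_agree_split:
  fixes f :: "(nat \<Rightarrow> bool) \<Rightarrow> real"
  assumes "finite W" "Q \<subseteq> W"
  shows "(\<Sum>z\<in>agree W \<rho>. f z) = (\<Sum>y\<in>agree (W - Q) \<rho>. \<Sum>z\<in>agree Q y. f z)"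
proof -
  \<comment> \<open>Resetting \<open>Q\<close> to the values of \<open>\<rho>\<close> maps the
    subcube of \<open>W\<close> onto that of \<open>W - Q\<close>, with fibres
    \<open>agree Q y\<close>.\<close>
  let ?g = "\<lambda>z v. if v \<in> Q then \<rho> v else z v"
  have "(\<Sum>z\<in>agree W \<rho>. f z) = (\<Sum>y\<in>agree (W - Q) \<rho>. sum f {z \<in> agree W \<rho>. ?g z = y})"
    using assms by (intro sum.group[symmetric] finite_agree finite_Diff) (auto simp: agree_def)
  also have "\<dots> = (\<Sum>y\<in>agree (W - Q) \<rho>. \<Sum>z\<in>agree Q y. f z)"
  proof (intro sum.cong refl)
    fix y assume y: "y \<in> agree (W - Q) \<rho>"
    show "{z \<in> agree W \<rho>. ?g z = y} = agree Q y"
    proof (intro Set.set_eqI iffI)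
      fix z assume "z \<in> agree Q y"
      thus "z \<in> {z \<in> agree W \<rho>. ?g z = y}"
        using y assms(2) by (auto simp: agree_def fun_eq_iff)
    qed (auto simp: agree_def)
  qed
  finally show ?thesis .
qed

definition shifted :: "'k constraint \<Rightarrow> (nat \<Rightarrow> bool) \<Rightarrow> 'k \<Rightarrow> bool" where
  "shifted e z = (\<lambda>q. z (snd e q) \<noteq> fst e q)"

text \<open>The product of the local distributions as a density relative to the uniform measure: for
  uniform \<open>\<mu>\<close> it is constantly 1.\<close>

definition weight :: "('k::finite \<Rightarrow> bool) pmf \<Rightarrow> (nat \<Rightarrow> 'k constraint) \<Rightarrow> nat set \<Rightarrow> (nat \<Rightarrow> bool) \<Rightarrow> real" where
  "weight \<mu> cs E z = (\<Prod>e\<in>E. 2 ^ CARD('k) * pmf \<mu> (shifted (cs e) z))"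

definition uniform_pmf :: "nat \<Rightarrow> ('k::finite \<Rightarrow> bool) pmf \<Rightarrow> bool" where
  "uniform_pmf s \<mu> \<longleftrightarrow> (\<forall>T \<alpha>. 1 \<le> card T \<and> card T \<le> s \<longrightarrow>
     measure_pmf.prob \<mu> {z. \<forall>i\<in>T. z i = \<alpha> i} = (1 / 2) ^ card T)"

lemma uniform_pmf_sum:
  assumes "uniform_pmf s \<mu>" "card T \<le> s"
  shows "(\<Sum>y\<in>{y. \<forall>i\<in>T. y i = \<alpha> i}. pmf \<mu> y) = (1 / 2) ^ card T"
proof (cases "card T = 0")
  case True
  hence "T = {}" by simp
  thus ?thesis using sum_pmf_eq_1[of UNIV \<mu>] by simp
next
  case False
  hence "1 \<le> card T" by linarith
  thus ?thesis using assms
    by (auto simp: uniform_pmf_def simp flip: measure_measure_pmf_finite)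
qed

text \<open>The positions of \<open>e\<close> that can be summed out without affecting other
  constraints. A variable repeated inside the scope of \<open>e\<close> is excluded too.\<close>

definition uniq :: "(nat \<Rightarrow> 'k::finite constraint) \<Rightarrow> nat set \<Rightarrow> nat set \<Rightarrow> nat \<Rightarrow> 'k set" where
  "uniq cs C E e = {q. snd (cs e) q \<notin> C \<and>
     (\<forall>e'\<in>E. \<forall>q'. snd (cs e') q' = snd (cs e) q \<longrightarrow> e' = e \<and> q' = q)}"

text \<open>Double counting: a fixed variable has at least one occurrence, and a free one has two
  occurrences or a single one that lies in \<open>uniq\<close>. Summation bounds
  \<open>|V| + |V - C|\<close> by \<open>k |E|\<close> plus the total size of the sets
  \<open>uniq\<close>. If every constraint had at least \<open>t\<close> positions outside
  \<open>uniq\<close>, this would be at most \<open>(2 k - t) |E|\<close> and the surplus at most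
  0.\<close>

lemma exists_peelable:
  fixes cs :: "nat \<Rightarrow> 'k::finite constraint"
  assumes fin: "finite E" and pos: "surplus cs t C E > 0"
  shows "\<exists>e\<in>E. CARD('k) - card (uniq cs C E e) < t"
proof (rule ccontr)
  assume neg: "\<not> ?thesis"
  define f where "f = (\<lambda>(e, q). snd (cs e) q)"
  define U where "U = Sigma E (uniq cs C E)"
  define A where "A = E \<times> (UNIV :: 'k set)"
  have finA: "finite A" and finU: "finite U" using fin by (auto simp: A_def U_def)
  have V: "vars cs E = f ` A" by (auto simp: vars_def A_def f_def)
  have UA: "U \<subseteq> A" by (auto simp: U_def A_def)
  have le: "1 + (if v \<in> C then 0 else 1) \<le> card {p\<in>A. f p = v} + card {p\<in>U. f p = v}"
    if v: "v \<in> vars cs E" for v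
  proof -
    obtain p where p: "p \<in> A" "f p = v" using v by (auto simp: V)
    have ge1: "card {p\<in>A. f p = v} \<ge> 1"
      using card_mono[of "{p\<in>A. f p = v}" "{p}"] p finA by simp
    show ?thesis
    proof (cases "v \<in> C")
      case False
      show ?thesis
      proof (cases "\<exists>p'\<in>A. f p' = v \<and> p' \<noteq> p")
        case True
        then obtain p' where p': "p' \<in> A" "f p' = v" "p' \<noteq> p" by blast
        have "card {p, p'} \<le> card {p\<in>A. f p = v}"
          using finA p p' by (intro card_mono) auto
        thus ?thesis using p' by simp
      next
        case un: False
        obtain e q where eq: "p = (e, q)" by (cases p)
        have v: "snd (cs e) q = v" and "e \<in> E" using p by (auto simp: eq f_def A_def)
        have "\<forall>e'\<in>E. \<forall>q'. snd (cs e') q' = v \<longrightarrow> e' = e \<and> q' = q"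
        proof (intro ballI allI impI)
          fix e' q' assume "e' \<in> E" "snd (cs e') q' = v"
          hence "(e', q') \<in> A" "f (e', q') = v" by (simp_all add: A_def f_def)
          with un eq show "e' = e \<and> q' = q" by blast
        qed
        hence "p \<in> U" using v False \<open>e \<in> E\<close> unfolding eq U_def uniq_def by blast
        hence "{p} \<subseteq> {p\<in>U. f p = v}" using p(2) by blast
        hence "card {p\<in>U. f p = v} \<ge> 1"
          using card_mono[of "{p\<in>U. f p = v}" "{p}"] finU by simp
        thus ?thesis using ge1 False by simp
      qed
    qed (use ge1 in simp)
  qed
  have "card (vars cs E) + card (vars cs E - C) = (\<Sum>v\<in>vars cs E. 1 + (if v \<in> C then 0 else 1))"
  proof -
    have "(\<Sum>v\<in>vars cs E. if v \<in> C then 0 else 1::nat) = (\<Sum>v\<in>vars cs E - C. 1)"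
      using fin by (intro sum.mono_neutral_cong_right) auto
    thus ?thesis by (simp only: sum.distrib) simp
  qed
  also have "\<dots> \<le> (\<Sum>v\<in>vars cs E. card {p\<in>A. f p = v} + card {p\<in>U. f p = v})"
    using le by (intro sum_mono) auto
  also have "\<dots> = (\<Sum>v\<in>vars cs E. \<Sum>p\<in>{p\<in>A. f p = v}. 1) + (\<Sum>v\<in>vars cs E. \<Sum>p\<in>{p\<in>U. f p = v}. 1)"
    by (simp add: sum.distrib)
  also have "\<dots> = card A + card U"
    using fin finA finU UA by (subst (1 2) sum.group) (auto simp: V)
  also have "card A = CARD('k) * card E" by (simp add: A_def card_cartesian_product)
  also have "card U = (\<Sum>e\<in>E. card (uniq cs C E e))" using fin by (simp add: U_def)
  finally have 1: "card (vars cs E) + card (vars cs E - C) \<le> CARD('k) * card E + (\<Sum>e\<in>E. card (uniq cs C E e))" .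
  have "(\<Sum>e\<in>E. card (uniq cs C E e) + t) \<le> (\<Sum>e\<in>E. CARD('k))"
  proof (rule sum_mono)
    fix e assume "e \<in> E"
    hence "t \<le> CARD('k) - card (uniq cs C E e)" using neg by (simp add: not_less)
    moreover have "card (uniq cs C E e) \<le> CARD('k)" by (intro card_mono) auto
    ultimately show "card (uniq cs C E e) + t \<le> CARD('k)" by linarith
  qed
  hence 2: "(\<Sum>e\<in>E. card (uniq cs C E e)) + t * card E \<le> CARD('k) * card E"
    by (simp add: sum.distrib mult.commute)
  have "int (card (vars cs E)) + int (card (vars cs E - C)) + int t * int (card E)
      \<le> 2 * (int CARD('k) * int (card E))"
    using 1 2 by (simp flip: of_nat_mult of_nat_add)
  thus False using pos by (simp add: surplus_def algebra_simps)
qed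

text \<open>Summing over the variables at \<open>U\<close> leaves the marginal of
  \<open>\<mu>\<close> on the at most \<open>s\<close> remaining positions, which is uniform; so the
  result does not depend on \<open>y\<close>.\<close>

lemma sum_agree_constraint:
  fixes \<mu> :: "('k::finite \<Rightarrow> bool) pmf"
  assumes u: "uniform_pmf s \<mu>" and inj: "inj_on (snd e) U"
    and sep: "\<And>q. q \<notin> U \<Longrightarrow> snd e q \<notin> snd e ` U" and c: "CARD('k) - card U \<le> s"
  shows "(\<Sum>z\<in>agree (snd e ` U) y. 2 ^ CARD('k) * pmf \<mu> (shifted e z)) = 2 ^ card U"
proof -
  let ?S = "snd e"
  let ?\<alpha> = "shifted e y"
  \<comment> \<open>The inverse of \<open>shifted e\<close> reads the value of a variable at its
    unique position in \<open>U\<close> and undoes the shift by \<open>fst e\<close>.\<close>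
  have "(\<Sum>z\<in>agree (?S ` U) y. pmf \<mu> (shifted e z)) = (\<Sum>y\<in>{y. \<forall>i\<in>-U. y i = ?\<alpha> i}. pmf \<mu> y)"
  proof (rule sum.reindex_bij_witness[where j = "shifted e"
        and i = "\<lambda>a v. if v \<in> ?S ` U then a (inv_into U ?S v) \<noteq> fst e (inv_into U ?S v) else y v"], goal_cases)
    case (1 z)
    thus ?case using inj by (auto simp: fun_eq_iff agree_def shifted_def)
  next
    case (2 z)
    thus ?case using sep by (auto simp: agree_def shifted_def)
  next
    case (3 a)
    show ?case
    proof
      fix q
      show "shifted e (\<lambda>v. if v \<in> ?S ` U then a (inv_into U ?S v) \<noteq> fst e (inv_into U ?S v) else y v) q = a q"
        using 3 sep[of q] inj by (cases "q \<in> U"; cases "fst e q") (simp_all add: shifted_def)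
    qed
  next
    case (4 a)
    show ?case by (auto simp: agree_def)
  next
    case (5 z) thus ?case by simp
  qed
  also have "\<dots> = (1 / 2) ^ card (- U)"
    by (rule uniform_pmf_sum[OF u]) (use c in \<open>simp add: Compl_eq_Diff_UNIV card_Diff_subset\<close>)
  finally have *: "(\<Sum>z\<in>agree (?S ` U) y. pmf \<mu> (shifted e z)) = (1 / 2) ^ card (- U)" .
  have "CARD('k) = card U + card (- U)"
    using card_mono[of UNIV U] by (simp add: Compl_eq_Diff_UNIV card_Diff_subset)
  hence "(2::real) ^ CARD('k) * (1/2) ^ card (- U) = 2 ^ card U"
    by (simp add: power_add power_one_over)
  thus ?thesis using * by (simp flip: sum_distrib_left)
qed

text \<open>Induction on \<open>card E\<close>: a peelable constraint is summed out over its unique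
  variables \<open>?Q\<close>, which contributes \<open>2 ^ card ?Q\<close> for every choice of the
  other variables.\<close>

lemma sum_weight:
  fixes \<mu> :: "('k::finite \<Rightarrow> bool) pmf"
  assumes "uniform_pmf (t - 1) \<mu>" "finite E" "finite W" "vars cs E \<subseteq> W \<union> C" "W \<inter> C = {}"
    and "\<And>E'. E' \<subseteq> E \<Longrightarrow> E' \<noteq> {} \<Longrightarrow> surplus cs t C E' > 0"
  shows "(\<Sum>z\<in>agree W \<rho>. weight \<mu> cs E z) = 2 ^ card W"
  using assms(2-)
proof (induction "card E" arbitrary: E W C)
  case 0
  hence "E = {}" by simp
  moreover have "(\<Sum>z\<in>agree W \<rho>. 1) = (2::real) ^ card W" if "finite W" for W
    using that
  proof (induction W rule: finite_induct)
    case (insert x F)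
    have "y(x := True) \<noteq> y(x := False)" for y :: "nat \<Rightarrow> bool"
      by (metis fun_upd_same)
    hence "(\<Sum>z\<in>agree {x} y. (1::real)) = 2" for y by (simp add: agree_singleton)
    thus ?case using insert by (subst sum_agree_split[of _ "{x}"]) (auto simp: sum_distrib_right)
  qed auto
  ultimately show ?case using 0 by (simp add: weight_def)
next
  case (Suc N)
  hence "E \<noteq> {}" by auto
  with Suc.prems obtain e where e: "e \<in> E" "CARD('k) - card (uniq cs C E e) < t"
    using exists_peelable[of E cs t C] by blast
  let ?U = "uniq cs C E e" and ?S = "snd (cs e)"
  let ?Q = "?S ` ?U" and ?E = "E - {e}"
  have QW: "?Q \<subseteq> W" using Suc.prems(3) e(1) by (fastforce simp: uniq_def vars_def)
  have inj: "inj_on ?S ?U" using e(1) by (auto simp: inj_on_def uniq_def)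
  have sep: "?S q \<notin> ?Q" if "q \<notin> ?U" for q
  proof
    assume "?S q \<in> ?Q"
    then obtain q' where "q' \<in> ?U" "?S q = ?S q'" by blast
    with e(1) have "q = q'" by (auto simp: uniq_def)
    with that \<open>q' \<in> ?U\<close> show False by simp
  qed
  have disj: "vars cs ?E \<inter> ?Q = {}" by (auto simp: vars_def uniq_def)
  have cst: "weight \<mu> cs ?E z = weight \<mu> cs ?E y" if "z \<in> agree ?Q y" for z y
  proof -
    have "shifted (cs e') z = shifted (cs e') y" if "e' \<in> ?E" for e'
    proof
      fix q
      have "snd (cs e') q \<notin> ?Q" using disj scope_in_vars[OF that, of cs q] by blast
      thus "shifted (cs e') z q = shifted (cs e') y q"
        using \<open>z \<in> agree ?Q y\<close> by (simp add: shifted_def agree_def)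
    qed
    thus ?thesis by (simp add: weight_def)
  qed
  have "(\<Sum>z\<in>agree W \<rho>. weight \<mu> cs E z) =
      (\<Sum>z\<in>agree W \<rho>. weight \<mu> cs ?E z * (2 ^ CARD('k) * pmf \<mu> (shifted (cs e) z)))"
    using Suc.prems(1) e(1) by (simp add: weight_def prod.remove mult.commute)
  also have "\<dots> = (\<Sum>y\<in>agree (W - ?Q) \<rho>. \<Sum>z\<in>agree ?Q y.
      weight \<mu> cs ?E z * (2 ^ CARD('k) * pmf \<mu> (shifted (cs e) z)))"
    by (rule sum_agree_split[OF Suc.prems(2) QW])
  also have "\<dots> = (\<Sum>y\<in>agree (W - ?Q) \<rho>. weight \<mu> cs ?E y *
      (\<Sum>z\<in>agree ?Q y. 2 ^ CARD('k) * pmf \<mu> (shifted (cs e) z)))"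
    using cst by (simp add: sum_distrib_left)
  also have "\<dots> = (\<Sum>y\<in>agree (W - ?Q) \<rho>. weight \<mu> cs ?E y * 2 ^ card ?Q)"
    using e(2) by (subst sum_agree_constraint[OF assms(1) inj sep]) (auto simp: card_image[OF inj])
  also have "\<dots> = 2 ^ card (W - ?Q) * 2 ^ card ?Q"
  proof -
    \<comment> \<open>Treating \<open>?Q\<close> as fixed does not lower the surplus of the
      remaining constraints, because none of them contains a variable of \<open>?Q\<close>.\<close>
    have "surplus cs t (C \<union> ?Q) E' > 0" if "E' \<subseteq> ?E" "E' \<noteq> {}" for E'
    proof -
      have "vars cs E' \<inter> ?Q = {}" using disj vars_mono[OF that(1), of cs] by blast
      moreover have "finite E'" using that(1) Suc.prems(1) by (meson finite_Diff finite_subset)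
      ultimately show ?thesis using Suc.prems(5)[of E'] that
        by (subst surplus_fix_more) auto
    qed
    hence "(\<Sum>y\<in>agree (W - ?Q) \<rho>. weight \<mu> cs ?E y) = 2 ^ card (W - ?Q)"
      using Suc.prems Suc.hyps(2) e(1) vars_mono[of ?E E cs]
      by (intro Suc.hyps(1)[of _ _ "C \<union> ?Q"]) auto
    thus ?thesis by (simp flip: sum_distrib_right)
  qed
  also have "\<dots> = 2 ^ card W"
    using QW Suc.prems(2) by (simp add: card_Diff_subset finite_subset card_mono flip: power_add)
  finally show ?case .
qed

section \<open>Convexity and protection matrices\<close>

text \<open>Convex combinations are indexed by finite sets of assignments, the index sets of all
  mixtures taken below.\<close>

definition convex_vec :: "nat \<Rightarrow> real vec set \<Rightarrow> bool" where
  "convex_vec n K \<longleftrightarrow> K \<subseteq> carrier_vec n \<and>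
     (\<forall>(Z :: (nat \<Rightarrow> bool) set) w X. finite Z \<and> (\<forall>z\<in>Z. w z \<ge> 0 \<and> X z \<in> K) \<and> sum w Z = 1 \<longrightarrow>
        Matrix.vec n (\<lambda>j. \<Sum>z\<in>Z. w z * X z $ j) \<in> K)"

lemma convex_vecD:
  fixes Z :: "(nat \<Rightarrow> bool) set"
  assumes "convex_vec n K" "finite Z" "\<And>z. z \<in> Z \<Longrightarrow> w z \<ge> 0" "\<And>z. z \<in> Z \<Longrightarrow> X z \<in> K" "sum w Z = 1"
  shows "Matrix.vec n (\<lambda>j. \<Sum>z\<in>Z. w z * X z $ j) \<in> K"
  using assms unfolding convex_vec_def by blast

lemma literal_sum:
  fixes Z :: "'z set"
  assumes "sum w Z = 1"
  shows "literal (\<Sum>z\<in>Z. w z * a z) b = (\<Sum>z\<in>Z. w z * literal (a z) b)"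
  using assms by (simp add: literal_def right_diff_distrib sum_subtractf)

text \<open>Literals are affine in the variable, so each inequality survives averaging. The bound on
  the scopes keeps the vector entries in range.\<close>

lemma convex_csp_polytope:
  assumes scope: "\<And>c S i. (c, S) \<in># I \<Longrightarrow> S i < n"
  shows "convex_vec n (csp_polytope n P I)"
  unfolding convex_vec_def
proof (intro conjI allI impI)
  show "csp_polytope n P I \<subseteq> carrier_vec n" by (auto simp: csp_polytope_def)
  fix Z :: "(nat \<Rightarrow> bool) set" and w :: "(nat \<Rightarrow> bool) \<Rightarrow> real" and X :: "(nat \<Rightarrow> bool) \<Rightarrow> real vec"
  assume A: "finite Z \<and> (\<forall>z\<in>Z. w z \<ge> 0 \<and> X z \<in> csp_polytope n P I) \<and> sum w Z = 1"
  let ?x = "Matrix.vec n (\<lambda>j. \<Sum>z\<in>Z. w z * X z $ j)"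
  have "(\<Sum>i\<in>UNIV. literal (?x $ S i) (c i \<noteq> f i)) \<ge> 1"
    if cS: "(c, S) \<in># I" and f: "\<not> P f" for c S f
  proof -
    have "(\<Sum>i\<in>UNIV. literal (?x $ S i) (c i \<noteq> f i)) =
        (\<Sum>i\<in>UNIV. \<Sum>z\<in>Z. w z * literal (X z $ S i) (c i \<noteq> f i))"
      using A scope[OF cS] by (simp add: literal_sum)
    also have "\<dots> = (\<Sum>z\<in>Z. w z * (\<Sum>i\<in>UNIV. literal (X z $ S i) (c i \<noteq> f i)))"
      by (subst sum.swap) (simp add: sum_distrib_left)
    also have "\<dots> \<ge> (\<Sum>z\<in>Z. w z * 1)"
    proof (intro sum_mono mult_left_mono)
      fix z assume "z \<in> Z"
      hence "X z \<in> csp_polytope n P I" using A by blast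
      thus "(\<Sum>i\<in>UNIV. literal (X z $ S i) (c i \<noteq> f i)) \<ge> 1"
        using cS f unfolding csp_polytope_def by blast
    qed (use A in auto)
    finally show ?thesis using A by simp
  qed
  thus "?x \<in> csp_polytope n P I" by (auto simp: csp_polytope_def)
qed

section \<open>The Lovasz-Schrijver step on convex sets\<close>

lemma homog_coneI: "l \<ge> 0 \<Longrightarrow> x \<in> K \<Longrightarrow> v = vCons l (l \<cdot>\<^sub>v x) \<Longrightarrow> v \<in> homog_cone K"
  by (auto simp: homog_cone_def)

text \<open>A combination of total height \<open>L > 0\<close> is \<open>L\<close> times a convex
  combination of the base points. For \<open>L = 0\<close> all terms vanish, and the apex is
  obtained from any base point; this is where \<open>Z \<noteq> {}\<close> enters.\<close>

lemma homog_cone_sum: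
  fixes Z :: "(nat \<Rightarrow> bool) set"
  assumes K: "convex_vec n K" and Z: "finite Z" "Z \<noteq> {}"
    and w: "\<And>z. z \<in> Z \<Longrightarrow> w z \<ge> 0" and V: "\<And>z. z \<in> Z \<Longrightarrow> V z \<in> homog_cone K"
  shows "Matrix.vec (n + 1) (\<lambda>j. \<Sum>z\<in>Z. w z * V z $ j) \<in> homog_cone K"
proof -
  have "\<forall>z\<in>Z. \<exists>l x. l \<ge> 0 \<and> x \<in> K \<and> V z = vCons l (l \<cdot>\<^sub>v x)"
    using V unfolding homog_cone_def by blast
  then obtain l X where lX: "\<And>z. z \<in> Z \<Longrightarrow> l z \<ge> 0 \<and> X z \<in> K \<and> V z = vCons (l z) (l z \<cdot>\<^sub>v X z)"
    by metis
  define L where "L = (\<Sum>z\<in>Z. w z * l z)"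
  have nn: "w z * l z \<ge> 0" if "z \<in> Z" for z using that w lX by simp
  have Xc: "X z \<in> carrier_vec n" if "z \<in> Z" for z using lX[OF that] K by (auto simp: convex_vec_def)
  have Vj: "V z $ j = (case j of 0 \<Rightarrow> l z | Suc j' \<Rightarrow> l z * X z $ j')" if "z \<in> Z" "j < n + 1" for z j
    using that lX[of z] Xc[of z] by (cases j) auto
  have L0: "L \<ge> 0" unfolding L_def using nn by (rule sum_nonneg)
  show ?thesis
  proof (cases "L = 0")
    case True
    hence z0: "w z * l z = 0" if "z \<in> Z" for z
      using sum_nonneg_eq_0_iff[of Z "\<lambda>z. w z * l z"] nn Z(1) that by (simp add: L_def)
    obtain z0 where "z0 \<in> Z" using Z by blast
    have "(\<Sum>z\<in>Z. w z * V z $ j) = 0" if "j < n + 1" for j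
    proof (rule sum.neutral, rule ballI)
      fix z assume "z \<in> Z"
      thus "w z * V z $ j = 0"
        using z0[of z] Vj[of z j] that by (auto split: nat.splits)
    qed
    hence "Matrix.vec (n + 1) (\<lambda>j. \<Sum>z\<in>Z. w z * V z $ j) = vCons 0 (0 \<cdot>\<^sub>v X z0)"
      using Xc[OF \<open>z0 \<in> Z\<close>] by (intro eq_vecI) (auto simp: vCons_def split: nat.splits)
    thus ?thesis using lX[OF \<open>z0 \<in> Z\<close>] by (intro homog_coneI[of 0]) auto
  next
    case False
    hence Lp: "L > 0" using L0 by simp
    let ?x = "Matrix.vec n (\<lambda>j. \<Sum>z\<in>Z. w z * l z / L * X z $ j)"
    have x: "?x \<in> K"
      using nn Lp lX by (intro convex_vecD[OF K Z(1)]) (auto simp: L_def simp flip: sum_divide_distrib)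
    have "Matrix.vec (n + 1) (\<lambda>j. \<Sum>z\<in>Z. w z * V z $ j) = vCons L (L \<cdot>\<^sub>v ?x)"
    proof (rule eq_vecI)
      fix j assume "j < dim_vec (vCons L (L \<cdot>\<^sub>v ?x))"
      hence j: "j < n + 1" by simp
      show "Matrix.vec (n + 1) (\<lambda>j. \<Sum>z\<in>Z. w z * V z $ j) $ j = vCons L (L \<cdot>\<^sub>v ?x) $ j"
        using j Vj Lp by (cases j) (auto simp: L_def sum_distrib_left mult.assoc intro!: sum.cong)
    qed simp
    thus ?thesis using x Lp by (intro homog_coneI[of L]) auto
  qed
qed

lemma psd_matI:
  assumes Y: "Y \<in> carrier_mat d d" and sym: "\<And>i j. i < d \<Longrightarrow> j < d \<Longrightarrow> Y $$ (i, j) = Y $$ (j, i)"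
    and q: "\<And>v. (\<Sum>i<d. \<Sum>j<d. v i * v j * Y $$ (i, j)) \<ge> 0"
  shows "psd_mat d Y"
  unfolding psd_mat_def
proof (intro conjI ballI)
  show "Y\<^sup>T = Y" using Y sym by (intro eq_matI) auto
  fix v :: "real vec" assume v: "v \<in> carrier_vec d"
  have "v \<bullet> (Y *\<^sub>v v) = (\<Sum>i<d. \<Sum>j<d. v $ i * v $ j * Y $$ (i, j))"
    using v Y by (auto simp: scalar_prod_def sum_distrib_left atLeast0LessThan intro!: sum.cong)
  thus "0 \<le> v \<bullet> (Y *\<^sub>v v)" using q[of "\<lambda>i. v $ i"] by simp
qed (fact Y)

lemma psd_matD:
  assumes "psd_mat d Y"
  shows "Y \<in> carrier_mat d d" "\<And>i j. i < d \<Longrightarrow> j < d \<Longrightarrow> Y $$ (i, j) = Y $$ (j, i)"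
    "(\<Sum>i<d. \<Sum>j<d. v i * v j * Y $$ (i, j)) \<ge> 0"
proof -
  show Y: "Y \<in> carrier_mat d d" using assms by (simp add: psd_mat_def)
  show "Y $$ (i, j) = Y $$ (j, i)" if "i < d" "j < d" for i j
  proof -
    have "Y $$ (i, j) = Y\<^sup>T $$ (i, j)" using assms by (simp add: psd_mat_def)
    also have "\<dots> = Y $$ (j, i)" using Y that by auto
    finally show ?thesis .
  qed
  let ?v = "Matrix.vec d v"
  have "?v \<bullet> (Y *\<^sub>v ?v) = (\<Sum>i<d. \<Sum>j<d. v i * v j * Y $$ (i, j))"
    using Y by (auto simp: scalar_prod_def sum_distrib_left atLeast0LessThan intro!: sum.cong)
  moreover have "?v \<bullet> (Y *\<^sub>v ?v) \<ge> 0" using assms by (auto simp: psd_mat_def)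
  ultimately show "(\<Sum>i<d. \<Sum>j<d. v i * v j * Y $$ (i, j)) \<ge> 0" by simp
qed

text \<open>The protection matrices are averaged with the same weights as the points; the column
  conditions survive because the cone over \<open>K\<close> is closed under nonnegative
  combinations.\<close>

lemma convex_N_plus:
  assumes K: "convex_vec n K"
  shows "convex_vec n (N_plus n K)"
  unfolding convex_vec_def
proof (intro conjI allI impI)
  show "N_plus n K \<subseteq> carrier_vec n" by (auto simp: N_plus_def)
  fix Z :: "(nat \<Rightarrow> bool) set" and w :: "(nat \<Rightarrow> bool) \<Rightarrow> real" and X :: "(nat \<Rightarrow> bool) \<Rightarrow> real vec"
  assume A: "finite Z \<and> (\<forall>z\<in>Z. w z \<ge> 0 \<and> X z \<in> N_plus n K) \<and> sum w Z = 1"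
  let ?x = "Matrix.vec n (\<lambda>j. \<Sum>z\<in>Z. w z * X z $ j)"
  let ?C = "homog_cone K"
  have Z: "finite Z" "Z \<noteq> {}" and w: "\<And>z. z \<in> Z \<Longrightarrow> w z \<ge> 0" using A by auto
  have Xc: "X z \<in> carrier_vec n" if "z \<in> Z" for z using A that by (auto simp: N_plus_def)
  have "\<forall>z\<in>Z. \<exists>Y. psd_mat (n + 1) Y \<and>
      (\<forall>i \<in> {0..n}. Y $$ (i, i) = vCons 1 (X z) $ i \<and> Y $$ (i, 0) = vCons 1 (X z) $ i) \<and>
      (\<forall>i \<in> {1..n}. col Y i \<in> ?C \<and> col Y 0 - col Y i \<in> ?C)"
    using A by (auto simp: N_plus_def N_plus_cone_def)
  then obtain Y where Y: "\<And>z. z \<in> Z \<Longrightarrow> psd_mat (n + 1) (Y z)"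
    "\<And>z i. z \<in> Z \<Longrightarrow> i \<le> n \<Longrightarrow> Y z $$ (i, i) = vCons 1 (X z) $ i \<and> Y z $$ (i, 0) = vCons 1 (X z) $ i"
    "\<And>z i. z \<in> Z \<Longrightarrow> 1 \<le> i \<Longrightarrow> i \<le> n \<Longrightarrow> col (Y z) i \<in> ?C \<and> col (Y z) 0 - col (Y z) i \<in> ?C"
    unfolding bchoice_iff by fastforce
  have Yc: "col (Y z) i $ j = Y z $$ (j, i)" "dim_vec (col (Y z) i) = n + 1" if "z \<in> Z" "i \<le> n" "j \<le> n" for z i j
    using psd_matD(1)[OF Y(1)[OF that(1)]] that by auto
  define T where "T = mat (n + 1) (n + 1) (\<lambda>(i, j). \<Sum>z\<in>Z. w z * Y z $$ (i, j))"
  have Tij: "T $$ (i, j) = (\<Sum>z\<in>Z. w z * Y z $$ (i, j))" if "i \<le> n" "j \<le> n" for i j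
    using that by (simp add: T_def)
  have psd: "psd_mat (n + 1) T"
  proof (rule psd_matI)
    show "T \<in> carrier_mat (n + 1) (n + 1)" by (simp add: T_def)
    show "T $$ (i, j) = T $$ (j, i)" if "i < n + 1" "j < n + 1" for i j
      using that psd_matD(2)[OF Y(1)] by (simp add: Tij)
    fix v :: "nat \<Rightarrow> real"
    have "(\<Sum>i<n+1. \<Sum>j<n+1. v i * v j * T $$ (i, j)) =
        (\<Sum>i<n+1. \<Sum>j<n+1. \<Sum>z\<in>Z. w z * (v i * v j * Y z $$ (i, j)))"
      by (intro sum.cong refl) (simp add: Tij sum_distrib_left mult_ac)
    also have "\<dots> = (\<Sum>i<n+1. \<Sum>z\<in>Z. \<Sum>j<n+1. w z * (v i * v j * Y z $$ (i, j)))"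
      by (intro sum.cong refl sum.swap)
    also have "\<dots> = (\<Sum>z\<in>Z. \<Sum>i<n+1. \<Sum>j<n+1. w z * (v i * v j * Y z $$ (i, j)))"
      by (rule sum.swap)
    also have "\<dots> = (\<Sum>z\<in>Z. w z * (\<Sum>i<n+1. \<Sum>j<n+1. v i * v j * Y z $$ (i, j)))"
      by (simp only: sum_distrib_left)
    also have "\<dots> \<ge> 0"
    proof (rule sum_nonneg)
      fix z assume "z \<in> Z"
      thus "w z * (\<Sum>i<n+1. \<Sum>j<n+1. v i * v j * Y z $$ (i, j)) \<ge> 0"
        using w psd_matD(3)[OF Y(1), of z v] by (intro mult_nonneg_nonneg)
    qed
    finally show "(\<Sum>i<n+1. \<Sum>j<n+1. v i * v j * T $$ (i, j)) \<ge> 0" .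
  qed
  have diag: "T $$ (i, i) = vCons 1 ?x $ i \<and> T $$ (i, 0) = vCons 1 ?x $ i" if "i \<le> n" for i
  proof -
    have "vCons 1 ?x $ i = (\<Sum>z\<in>Z. w z * vCons 1 (X z) $ i)"
      using that A by (cases i) auto
    thus ?thesis using that Y(2) by (simp add: Tij)
  qed
  have cols: "col T i \<in> ?C \<and> col T 0 - col T i \<in> ?C" if i: "1 \<le> i" "i \<le> n" for i
  proof
    have "Matrix.vec (n + 1) (\<lambda>j. \<Sum>z\<in>Z. w z * col (Y z) i $ j) \<in> ?C"
      using Y(3) i w by (intro homog_cone_sum[OF K Z]) auto
    moreover have "Matrix.vec (n + 1) (\<lambda>j. \<Sum>z\<in>Z. w z * col (Y z) i $ j) = col T i"
      using i by (intro eq_vecI) (auto simp: T_def Yc intro!: sum.cong)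
    ultimately show "col T i \<in> ?C" by simp
    have "Matrix.vec (n + 1) (\<lambda>j. \<Sum>z\<in>Z. w z * (col (Y z) 0 - col (Y z) i) $ j) \<in> ?C"
      using Y(3) i w by (intro homog_cone_sum[OF K Z]) auto
    moreover have "(col (Y z) 0 - col (Y z) i) $ j = Y z $$ (j, 0) - Y z $$ (j, i)"
      if "z \<in> Z" "j < n + 1" for z j
      using i that Yc[of z 0 j] Yc[of z i j] by simp
    hence "Matrix.vec (n + 1) (\<lambda>j. \<Sum>z\<in>Z. w z * (col (Y z) 0 - col (Y z) i) $ j) = col T 0 - col T i"
      using i by (intro eq_vecI) (auto simp: T_def Yc right_diff_distrib simp flip: sum_subtractf intro!: sum.cong)
    ultimately show "col T 0 - col T i \<in> ?C" by simp
  qed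
  show "?x \<in> N_plus n K"
    unfolding N_plus_def N_plus_cone_def using psd diag cols by (auto intro!: exI[of _ T])
qed

lemma convex_N_plus_funpow: "convex_vec n K \<Longrightarrow> convex_vec n ((N_plus n ^^ r) K)"
  by (induction r) (auto intro: convex_N_plus)

text \<open>The protection matrix is \<open>M\<close> bordered by \<open>x\<close> and 1. By the
  Schur complement of the corner entry it suffices that the covariance form
  \<open>M i j - x i * x j\<close> is nonnegative.\<close>

lemma N_plusI:
  fixes M :: "nat \<Rightarrow> nat \<Rightarrow> real"
  assumes x: "x \<in> carrier_vec n"
    and sym: "\<And>i j. i < n \<Longrightarrow> j < n \<Longrightarrow> M i j = M j i" and diag: "\<And>i. i < n \<Longrightarrow> M i i = x $ i"
    and cov: "\<And>u. (\<Sum>i<n. \<Sum>j<n. u i * u j * (M i j - x $ i * x $ j)) \<ge> 0"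
    and col1: "\<And>i. i < n \<Longrightarrow> vCons (x $ i) (Matrix.vec n (M i)) \<in> homog_cone K"
    and col0: "\<And>i. i < n \<Longrightarrow> vCons (1 - x $ i) (Matrix.vec n (\<lambda>j. x $ j - M i j)) \<in> homog_cone K"
  shows "x \<in> N_plus n K"
proof -
  define m where "m i j = (case i of 0 \<Rightarrow> vCons 1 x $ j | Suc i' \<Rightarrow>
     (case j of 0 \<Rightarrow> x $ i' | Suc j' \<Rightarrow> M i' j'))" for i j
  define T where "T = mat (n + 1) (n + 1) (\<lambda>(i, j). m i j)"
  have Tij: "T $$ (i, j) = m i j" if "i \<le> n" "j \<le> n" for i j
    using that by (simp add: T_def)
  have psd: "psd_mat (n + 1) T"
  proof (rule psd_matI)
    show "T \<in> carrier_mat (n + 1) (n + 1)" by (simp add: T_def)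
    show "T $$ (i, j) = T $$ (j, i)" if "i < n + 1" "j < n + 1" for i j
      using that sym by (cases i; cases j) (auto simp: Tij m_def)
    fix v :: "nat \<Rightarrow> real"
    let ?u = "\<lambda>i. v (Suc i)"
    let ?s = "\<Sum>i<n. ?u i * x $ i"
    have "(\<Sum>i<n+1. \<Sum>j<n+1. v i * v j * T $$ (i, j)) = (\<Sum>i<Suc n. \<Sum>j<Suc n. v i * v j * m i j)"
      by (intro sum.cong) (auto simp: Tij)
    also have "\<dots> = v 0 * v 0 + (\<Sum>j<n. v 0 * ?u j * x $ j) +
        ((\<Sum>i<n. ?u i * v 0 * x $ i) + (\<Sum>i<n. \<Sum>j<n. ?u i * ?u j * M i j))"
      by (simp only: sum.lessThan_Suc_shift) (simp add: m_def sum.distrib)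
    also have "(\<Sum>i<n. \<Sum>j<n. ?u i * ?u j * M i j) =
        (\<Sum>i<n. \<Sum>j<n. ?u i * ?u j * (M i j - x $ i * x $ j)) + ?s * ?s"
      by (simp add: sum_product algebra_simps flip: sum.distrib)
    also have "(\<Sum>j<n. v 0 * ?u j * x $ j) = v 0 * ?s" by (simp add: sum_distrib_left mult_ac)
    also have "(\<Sum>j<n. ?u j * v 0 * x $ j) = v 0 * ?s" by (simp add: sum_distrib_left mult_ac)
    \<comment> \<open>Completing the square separates the border from the covariance form.\<close>
    also have "v 0 * v 0 + v 0 * ?s +
        (v 0 * ?s + ((\<Sum>i<n. \<Sum>j<n. ?u i * ?u j * (M i j - x $ i * x $ j)) + ?s * ?s))
       = (v 0 + ?s)\<^sup>2 + (\<Sum>i<n. \<Sum>j<n. ?u i * ?u j * (M i j - x $ i * x $ j))"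
      by (simp add: power2_eq_square algebra_simps)
    also have "\<dots> \<ge> 0" using cov[of ?u] by simp
    finally show "(\<Sum>i<n+1. \<Sum>j<n+1. v i * v j * T $$ (i, j)) \<ge> 0" .
  qed
  have diagT: "T $$ (i, i) = vCons 1 x $ i \<and> T $$ (i, 0) = vCons 1 x $ i" if "i \<le> n" for i
    using that diag x by (cases i) (auto simp: Tij m_def)
  have cols: "col T i \<in> homog_cone K \<and> col T 0 - col T i \<in> homog_cone K"
    if i: "1 \<le> i" "i \<le> n" for i
  proof -
    obtain i' where i': "i = Suc i'" "i' < n" using i by (cases i) auto
    have "col T i $ j = vCons (x $ i') (Matrix.vec n (M i')) $ j" if "j < n + 1" for j
      using that i' sym x by (cases j) (auto simp: T_def m_def)
    hence c1: "col T i = vCons (x $ i') (Matrix.vec n (M i'))"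
      by (intro eq_vecI) (auto simp: T_def)
    have "(col T 0 - col T i) $ j = vCons (1 - x $ i') (Matrix.vec n (\<lambda>j. x $ j - M i' j)) $ j"
      if "j < n + 1" for j
      using that i' sym x by (cases j) (auto simp: T_def m_def)
    hence c0: "col T 0 - col T i = vCons (1 - x $ i') (Matrix.vec n (\<lambda>j. x $ j - M i' j))"
      by (intro eq_vecI) (auto simp: T_def)
    show ?thesis using c1 c0 col1[OF i'(2)] col0[OF i'(2)] by simp
  qed
  show ?thesis
    unfolding N_plus_def N_plus_cone_def using x psd diagT cols by (auto intro!: exI[of _ T])
qed

section \<open>Protection matrices from independent blocks\<close>

definition half_point :: "nat \<Rightarrow> nat set \<Rightarrow> (nat \<Rightarrow> bool) \<Rightarrow> real vec" where
  "half_point n C \<rho> = Matrix.vec n (\<lambda>j. if j \<in> C then of_bool (\<rho> j) else 1 / 2)"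

text \<open>The blocks \<open>B i\<close> partition the free variables, and \<open>p i\<close> is a
  distribution on assignments \<open>Z i\<close> of a block with marginals 1/2. Sampling the blocks
  independently gives the second moments \<open>M\<close>. Given the value of \<open>i\<close>, the
  point is a mixture of the states in which the block of \<open>i\<close> is sampled and all other
  free variables stay at 1/2, and these states lie in \<open>K\<close>.\<close>

lemma half_point_in_N_plus:
  fixes p :: "nat \<Rightarrow> (nat \<Rightarrow> bool) \<Rightarrow> real"
  assumes K: "convex_vec n K" and xK: "half_point n C \<rho> \<in> K"
    and self: "\<And>i. i < n \<Longrightarrow> i \<notin> C \<Longrightarrow> i \<in> B i"
    and block: "\<And>i j. i < n \<Longrightarrow> i \<notin> C \<Longrightarrow> j \<in> B i \<Longrightarrow> j \<notin> C \<and> B j = B i"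
    and same: "\<And>i j. i < n \<Longrightarrow> i \<notin> C \<Longrightarrow> j \<in> B i \<Longrightarrow> Z j = Z i \<and> p j = p i"
    and fin: "\<And>i. i < n \<Longrightarrow> i \<notin> C \<Longrightarrow> finite (Z i)"
    and nonneg: "\<And>i z. i < n \<Longrightarrow> i \<notin> C \<Longrightarrow> z \<in> Z i \<Longrightarrow> p i z \<ge> 0"
    and one: "\<And>i. i < n \<Longrightarrow> i \<notin> C \<Longrightarrow> sum (p i) (Z i) = 1"
    and half: "\<And>i j. i < n \<Longrightarrow> i \<notin> C \<Longrightarrow> j \<in> B i \<Longrightarrow> (\<Sum>z\<in>Z i. p i z * of_bool (z j)) = 1 / 2"
    and ext: "\<And>i j z. i < n \<Longrightarrow> i \<notin> C \<Longrightarrow> z \<in> Z i \<Longrightarrow> j \<in> C \<Longrightarrow> z j = \<rho> j"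
    and next_state: "\<And>i z. i < n \<Longrightarrow> i \<notin> C \<Longrightarrow> z \<in> Z i \<Longrightarrow> p i z > 0 \<Longrightarrow> half_point n (C \<union> B i) z \<in> K"
  shows "half_point n C \<rho> \<in> N_plus n K"
proof -
  let ?x = "half_point n C \<rho>"
  have x: "?x $ j = (if j \<in> C then of_bool (\<rho> j) else 1 / 2)" if "j < n" for j
    using that by (simp add: half_point_def)
  define M where "M i j = (if i \<notin> C \<and> j \<notin> C \<and> B i = B j
      then (\<Sum>z\<in>Z i. p i z * (of_bool (z i) * of_bool (z j))) else ?x $ i * ?x $ j)" for i j
  define f :: "nat \<Rightarrow> (nat \<Rightarrow> bool) \<Rightarrow> real" where "f i z = of_bool (z i) - 1 / 2" for i z
  have xc: "?x \<in> carrier_vec n" by (simp add: half_point_def)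
  have same': "Z j = Z i \<and> p j = p i" if "i < n" "i \<notin> C" "j < n" "j \<notin> C" "B i = B j" for i j
    using same[of i j] self[of j] that by simp
  \<comment> \<open>Averaging the next states gives back the current point, so the column for the
    value \<open>False\<close> follows from that for \<open>True\<close> by subtraction.\<close>
  have mom: "(\<Sum>z\<in>Z i. p i z * half_point n (C \<union> B i) z $ j) = ?x $ j"
    if "i < n" "i \<notin> C" "j < n" for i j
  proof -
    consider "j \<in> C" | "j \<notin> C" "j \<in> B i" | "j \<notin> C" "j \<notin> B i" by blast
    thus ?thesis
    proof cases
      case 1
      hence "(\<Sum>z\<in>Z i. p i z * half_point n (C \<union> B i) z $ j) = (\<Sum>z\<in>Z i. p i z * of_bool (\<rho> j))"
        using that ext by (intro sum.cong) (auto simp: half_point_def)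
      thus ?thesis using 1 that one x by (simp flip: sum_distrib_right)
    next
      case 2
      thus ?thesis using that half[of i j] x by (simp add: half_point_def)
    next
      case 3
      thus ?thesis using that one[of i] x by (simp add: half_point_def flip: sum_divide_distrib)
    qed
  qed
  have Mi: "M i j = (\<Sum>z\<in>{z\<in>Z i. z i = True}. p i z * half_point n (C \<union> B i) z $ j)"
    if i: "i < n" "i \<notin> C" and j: "j < n" for i j
  proof -
    have hi: "(\<Sum>z\<in>{z\<in>Z i. z i}. p i z) = 1 / 2"
      using half[OF i self[OF i]] fin[OF i] by (simp add: sum.If_cases Int_def of_bool_def if_distrib cong: if_cong)
    consider "j \<in> C" | "j \<notin> C" "j \<in> B i" | "j \<notin> C" "j \<notin> B i" by blast
    thus ?thesis
    proof cases
      case 1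
      hence "(\<Sum>z\<in>{z\<in>Z i. z i}. p i z * half_point n (C \<union> B i) z $ j) = (\<Sum>z\<in>{z\<in>Z i. z i}. p i z * of_bool (\<rho> j))"
        using i j ext by (intro sum.cong) (auto simp: half_point_def)
      thus ?thesis using 1 i j hi x by (simp add: M_def flip: sum_distrib_right)
    next
      case 2
      have "(\<Sum>z\<in>Z i. p i z * (of_bool (z i) * of_bool (z j))) = (\<Sum>z\<in>{z\<in>Z i. z i}. p i z * of_bool (z j))"
        using fin[OF i] by (intro sum.mono_neutral_cong_right) auto
      thus ?thesis using 2 i j block[OF i 2(2)] by (simp add: M_def half_point_def)
    next
      case 3
      hence "B i \<noteq> B j" using self[of j] j by auto
      thus ?thesis using 3 i j hi x by (simp add: M_def half_point_def flip: sum_divide_distrib)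
    qed
  qed
  have cone: "vCons (1 / 2) (Matrix.vec n (\<lambda>j. \<Sum>z\<in>{z\<in>Z i. z i = b}. p i z * half_point n (C \<union> B i) z $ j)) \<in> homog_cone K"
    if i: "i < n" "i \<notin> C" for i b
  proof -
    \<comment> \<open>Outcomes of probability 0 are dropped, since \<open>next_state\<close> speaks
      only of possible outcomes. The remaining mass is 1/2, hence the factor 2 in
      \<open>?y\<close>.\<close>
    let ?Z = "{z\<in>Z i. z i = b \<and> p i z > 0}"
    have cut: "(\<Sum>z\<in>{z\<in>Z i. z i = b}. p i z * g z) = (\<Sum>z\<in>?Z. p i z * g z)" for g :: "_ \<Rightarrow> real"
      using fin[OF i] nonneg[OF i] by (intro sum.mono_neutral_right) (auto simp: order_le_less)
    have T: "(\<Sum>z\<in>{z\<in>Z i. z i}. p i z) = 1 / 2"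
      using half[OF i self[OF i]] fin[OF i] by (simp add: sum.If_cases Int_def of_bool_def if_distrib cong: if_cong)
    have "(\<Sum>z\<in>{z\<in>Z i. z i}. p i z) + (\<Sum>z\<in>{z\<in>Z i. \<not> z i}. p i z) = sum (p i) (Z i)"
      using fin[OF i] by (subst sum.union_disjoint[symmetric]) (auto intro!: sum.cong)
    hence hb: "(\<Sum>z\<in>{z\<in>Z i. z i = b}. p i z) = 1 / 2"
      using T one[OF i] by (cases b) auto
    hence hb': "(\<Sum>z\<in>?Z. p i z) = 1 / 2" using cut[of "\<lambda>_. 1"] by simp
    let ?y = "Matrix.vec n (\<lambda>j. \<Sum>z\<in>?Z. 2 * p i z * half_point n (C \<union> B i) z $ j)"
    have "?y \<in> K"
    proof (rule convex_vecD[OF K])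
      show "finite ?Z" using fin[OF i] by simp
      show "(\<Sum>z\<in>?Z. 2 * p i z) = 1" using hb' by (simp flip: sum_distrib_left)
    qed (use next_state[OF i] in auto)
    moreover have "vCons (1 / 2) (Matrix.vec n (\<lambda>j. \<Sum>z\<in>{z\<in>Z i. z i = b}. p i z * half_point n (C \<union> B i) z $ j))
        = vCons (1 / 2) ((1 / 2) \<cdot>\<^sub>v ?y)"
      unfolding cut by (auto intro!: eq_vecI simp: sum_distrib_left)
    ultimately show ?thesis by (intro homog_coneI[of "1/2" ?y]) auto
  qed
  show ?thesis
  proof (rule N_plusI[OF xc, of M])
    show "M i j = M j i" if "i < n" "j < n" for i j
      using same'[of i j] that by (auto simp: M_def mult.commute)
    show "M i i = ?x $ i" if "i < n" for i
      using that half[of i i] self[of i] x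
      by (cases "i \<in> C") (auto simp: M_def simp flip: of_bool_conj)
    fix u :: "nat \<Rightarrow> real"
    let ?S = "{i. i < n \<and> i \<notin> C}"
    \<comment> \<open>Covariances are moments of the centred values \<open>f\<close>; they vanish
      between different blocks by independence.\<close>
    have cov: "M i j - ?x $ i * ?x $ j = (if B i = B j then (\<Sum>z\<in>Z i. p i z * (f i z * f j z)) else 0)"
      if i: "i \<in> ?S" and j: "j \<in> ?S" for i j
    proof (cases "B i = B j")
      case True
      have "(\<Sum>z\<in>Z i. p i z * (f i z * f j z)) = (\<Sum>z\<in>Z i. p i z * (of_bool (z i) * of_bool (z j)))
          - (\<Sum>z\<in>Z i. p i z * of_bool (z i)) / 2 - (\<Sum>z\<in>Z i. p i z * of_bool (z j)) / 2 + sum (p i) (Z i) / 4"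
      proof -
        have "p i z * (f i z * f j z) = p i z * (of_bool (z i) * of_bool (z j))
            - p i z * of_bool (z i) / 2 - p i z * of_bool (z j) / 2 + p i z / 4" for z
          by (simp add: f_def field_simps)
        thus ?thesis by (simp only: sum.distrib sum_subtractf sum_divide_distrib)
      qed
      also have "\<dots> = M i j - ?x $ i * ?x $ j"
        using True i j half[of i i] half[of i j] one[of i] self[of i] self[of j] x by (simp add: M_def)
      finally show ?thesis using True by simp
    qed (use i j in \<open>simp add: M_def\<close>)
    have z: "M i j - ?x $ i * ?x $ j = 0" if "\<not> (i \<in> ?S \<and> j \<in> ?S)" "i < n" "j < n" for i j
      using that by (auto simp: M_def)
    have "(\<Sum>i<n. \<Sum>j<n. u i * u j * (M i j - ?x $ i * ?x $ j)) =
        (\<Sum>i\<in>?S. \<Sum>j\<in>?S. u i * u j * (M i j - ?x $ i * ?x $ j))"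
    proof -
      have "(\<Sum>j<n. u i * u j * (M i j - ?x $ i * ?x $ j)) = (\<Sum>j\<in>?S. u i * u j * (M i j - ?x $ i * ?x $ j))"
        if "i < n" for i using z that by (intro sum.mono_neutral_right) auto
      hence "(\<Sum>i<n. \<Sum>j<n. u i * u j * (M i j - ?x $ i * ?x $ j)) =
          (\<Sum>i<n. \<Sum>j\<in>?S. u i * u j * (M i j - ?x $ i * ?x $ j))" by simp
      also have "\<dots> = (\<Sum>i\<in>?S. \<Sum>j\<in>?S. u i * u j * (M i j - ?x $ i * ?x $ j))"
        using z by (intro sum.mono_neutral_right) auto
      finally show ?thesis .
    qed
    also have "\<dots> = (\<Sum>i\<in>?S. \<Sum>j\<in>{j\<in>?S. B j = B i}. u i * u j * (\<Sum>z\<in>Z i. p i z * (f i z * f j z)))"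
      by (intro sum.cong refl sum.mono_neutral_cong_right) (auto simp: cov)
    also have "\<dots> = (\<Sum>b\<in>B ` ?S. \<Sum>i\<in>{i\<in>?S. B i = b}. \<Sum>j\<in>{j\<in>?S. B j = B i}.
        u i * u j * (\<Sum>z\<in>Z i. p i z * (f i z * f j z)))"
      by (rule sum.group[symmetric]) auto
    also have "\<dots> \<ge> 0"
    proof (rule sum_nonneg)
      fix b assume "b \<in> B ` ?S"
      then obtain i0 where i0: "i0 < n" "i0 \<notin> C" "b = B i0" by auto
      let ?Sb = "{i\<in>?S. B i = b}"
      have "(\<Sum>i\<in>?Sb. \<Sum>j\<in>{j\<in>?S. B j = B i}. u i * u j * (\<Sum>z\<in>Z i. p i z * (f i z * f j z)))
          = (\<Sum>i\<in>?Sb. \<Sum>j\<in>?Sb. \<Sum>z\<in>Z i0. p i0 z * ((u i * f i z) * (u j * f j z)))"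
      proof (intro sum.cong refl)
        fix i j assume i: "i \<in> ?Sb"
        have "Z i = Z i0 \<and> p i = p i0" using same'[of i0 i] i i0 by auto
        thus "u i * u j * (\<Sum>z\<in>Z i. p i z * (f i z * f j z)) =
            (\<Sum>z\<in>Z i0. p i0 z * ((u i * f i z) * (u j * f j z)))"
          by (simp add: sum_distrib_left mult_ac)
      qed (use i0 in auto)
      also have "\<dots> = (\<Sum>i\<in>?Sb. \<Sum>z\<in>Z i0. \<Sum>j\<in>?Sb. p i0 z * ((u i * f i z) * (u j * f j z)))"
        by (intro sum.cong refl sum.swap)
      also have "\<dots> = (\<Sum>z\<in>Z i0. \<Sum>i\<in>?Sb. \<Sum>j\<in>?Sb. p i0 z * ((u i * f i z) * (u j * f j z)))"
        by (rule sum.swap)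
      \<comment> \<open>Within one block the form is the expectation of a square.\<close>
      also have "\<dots> = (\<Sum>z\<in>Z i0. p i0 z * (\<Sum>i\<in>?Sb. u i * f i z)\<^sup>2)"
        by (simp only: power2_eq_square sum_product) (simp only: sum_distrib_left)
      also have "\<dots> \<ge> 0" using nonneg i0 by (intro sum_nonneg mult_nonneg_nonneg) auto
      finally show "(\<Sum>i\<in>?Sb. \<Sum>j\<in>{j\<in>?S. B j = B i}. u i * u j * (\<Sum>z\<in>Z i. p i z * (f i z * f j z))) \<ge> 0" .
    qed
    finally show "(\<Sum>i<n. \<Sum>j<n. u i * u j * (M i j - ?x $ i * ?x $ j)) \<ge> 0" .
  next
    fix i assume i: "i < n"
    \<comment> \<open>For a fixed variable \<open>i\<close> the two columns are the current point
      scaled by 0 and 1, so the current point itself must lie in \<open>K\<close>.\<close>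
    have scale: "vCons a (Matrix.vec n (\<lambda>j. a * ?x $ j)) \<in> homog_cone K" if "a \<ge> 0" for a
      using that xK xc by (intro homog_coneI[of a ?x]) (auto intro!: eq_vecI)
    show "vCons (?x $ i) (Matrix.vec n (M i)) \<in> homog_cone K"
    proof (cases "i \<in> C")
      case True
      hence "Matrix.vec n (M i) = Matrix.vec n (\<lambda>j. ?x $ i * ?x $ j)"
        by (intro eq_vecI) (auto simp: M_def)
      thus ?thesis using scale[of "?x $ i"] True i x by simp
    next
      case False
      have "Matrix.vec n (M i) = Matrix.vec n (\<lambda>j. \<Sum>z\<in>{z\<in>Z i. z i = True}. p i z * half_point n (C \<union> B i) z $ j)"
        using Mi[OF i False] by (intro eq_vecI) auto
      thus ?thesis using cone[OF i False, of True] False i x by simp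
    qed
    show "vCons (1 - ?x $ i) (Matrix.vec n (\<lambda>j. ?x $ j - M i j)) \<in> homog_cone K"
    proof (cases "i \<in> C")
      case True
      hence "Matrix.vec n (\<lambda>j. ?x $ j - M i j) = Matrix.vec n (\<lambda>j. (1 - ?x $ i) * ?x $ j)"
        by (intro eq_vecI) (auto simp: M_def algebra_simps)
      thus ?thesis using scale[of "1 - ?x $ i"] True i x by simp
    next
      case False
      have "?x $ j - M i j = (\<Sum>z\<in>{z\<in>Z i. z i = False}. p i z * half_point n (C \<union> B i) z $ j)"
        if "j < n" for j
      proof -
        let ?g = "\<lambda>z. p i z * half_point n (C \<union> B i) z $ j"
        have "sum ?g {z\<in>Z i. z i = True} + sum ?g {z\<in>Z i. z i = False} = sum ?g (Z i)"
          using fin[OF i False] by (subst sum.union_disjoint[symmetric]) (auto intro!: sum.cong)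
        thus ?thesis using mom[OF i False that] Mi[OF i False that] by simp
      qed
      hence "Matrix.vec n (\<lambda>j. ?x $ j - M i j) =
          Matrix.vec n (\<lambda>j. \<Sum>z\<in>{z\<in>Z i. z i = False}. p i z * half_point n (C \<union> B i) z $ j)"
        by (intro eq_vecI) auto
      thus ?thesis using cone[OF i False, of False] False i x by simp
    qed
  qed
qed

section \<open>Clusters and rounds\<close>

text \<open>Used with \<open>h\<close> equal to the least surplus of small nonempty sets: 1 for the
  initial fixing, 2 during the rounds.\<close>

definition tight :: "(nat \<Rightarrow> 'k::finite constraint) \<Rightarrow> nat \<Rightarrow> nat set \<Rightarrow> nat set \<Rightarrow> nat \<Rightarrow> int \<Rightarrow> nat set set" where
  "tight cs t C L s h = {A. A \<noteq> {} \<and> A \<subseteq> L \<and> card A \<le> s \<and> surplus cs t C A \<le> h}"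

text \<open>The largest tight set containing a free variable \<open>v\<close>, under the assumptions
  of the locale below; empty if \<open>v\<close> lies in no tight set.\<close>

definition cluster :: "(nat \<Rightarrow> 'k::finite constraint) \<Rightarrow> nat \<Rightarrow> nat set \<Rightarrow> nat set \<Rightarrow> nat \<Rightarrow> int \<Rightarrow> nat \<Rightarrow> nat set" where
  "cluster cs t C L s h v = \<Union>{A \<in> tight cs t C L s h. v \<in> vars cs A}"

text \<open>\<open>small\<close> keeps the union of two tight sets within the size bound
  \<open>s\<close>. \<open>h \<le> 2\<close> is what a shared free variable pays for when two
  disjoint tight sets are joined.\<close>

locale expanding =
  fixes cs :: "nat \<Rightarrow> 'k::finite constraint" and t :: nat and C L :: "nat set" and s :: nat and h :: int
  assumes finL: "finite L" and h2: "h \<le> 2"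
    and ge: "\<And>A. A \<subseteq> L \<Longrightarrow> A \<noteq> {} \<Longrightarrow> card A \<le> s \<Longrightarrow> surplus cs t C A \<ge> h"
    and small: "\<And>A. A \<in> tight cs t C L s h \<Longrightarrow> 2 * card A \<le> s"
begin

abbreviation "tgt \<equiv> tight cs t C L s h"
abbreviation "clu \<equiv> cluster cs t C L s h"

lemma finite_sub: "A \<subseteq> L \<Longrightarrow> finite A"
  using finL finite_subset by blast

text \<open>If the sets intersect, submodularity applies and the intersection has surplus at least
  \<open>h\<close>. If they are disjoint, the shared free variable costs 2, and
  \<open>2 h - 2 \<le> h\<close>.\<close>

lemma tight_Un:
  assumes A: "A \<in> tgt" and B: "B \<in> tgt" and v: "v \<in> vars cs A" "v \<in> vars cs B" "v \<notin> C"
  shows "A \<union> B \<in> tgt"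
proof -
  have AB: "A \<noteq> {}" "A \<subseteq> L" "surplus cs t C A \<le> h" "B \<subseteq> L" "surplus cs t C B \<le> h"
    "card A \<le> s"
    using A B by (auto simp: tight_def)
  have fin: "finite A" "finite B" using AB finite_sub by auto
  have "card (A \<union> B) \<le> s" using card_Un_le[of A B] small[OF A] small[OF B] by linarith
  moreover have "surplus cs t C (A \<union> B) \<le> h"
  proof (cases "A \<inter> B = {}")
    case True
    have "{v} \<subseteq> vars cs A \<inter> vars cs B - C" using v by blast
    hence "card (vars cs A \<inter> vars cs B - C) \<ge> 1"
      using card_mono[of "vars cs A \<inter> vars cs B - C" "{v}"] fin by simp
    moreover have "card (vars cs A \<inter> vars cs B - C) \<le> card (vars cs A \<inter> vars cs B)"
      using fin by (intro card_mono) auto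
    ultimately show ?thesis
      using surplus_Un_disjoint[OF fin True, of cs t C] AB h2 by linarith
  next
    case False
    have "card (A \<inter> B) \<le> s" using AB(6) card_mono[of A "A \<inter> B"] fin by simp
    hence "surplus cs t C (A \<inter> B) \<ge> h" using False AB by (intro ge) auto
    thus ?thesis using surplus_submodular[OF fin, of cs t C] AB by linarith
  qed
  ultimately show ?thesis using AB by (auto simp: tight_def)
qed

lemma cluster_tight:
  assumes A: "A \<in> tgt" and v: "v \<in> vars cs A" "v \<notin> C"
  shows "clu v \<in> tgt" "v \<in> vars cs (clu v)" "A \<subseteq> clu v"
proof -
  let ?F = "{A \<in> tgt. v \<in> vars cs A}"
  have "finite ?F" using finL by (rule finite_subset[rotated, OF finite_Pow_iff[THEN iffD2]]) (auto simp: tight_def)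
  moreover have "?F \<noteq> {}" using A v by blast
  moreover have "\<Union>F \<in> tgt \<and> v \<in> vars cs (\<Union>F)" if "finite F" "F \<noteq> {}" "F \<subseteq> ?F" for F
    using that
  proof (induction F rule: finite_ne_induct)
    case (insert B F)
    hence "B \<union> \<Union>F \<in> tgt" using v by (intro tight_Un[of _ _ v]) auto
    thus ?case using insert by (auto simp: vars_Un)
  qed auto
  ultimately show "clu v \<in> tgt" "v \<in> vars cs (clu v)" unfolding cluster_def by blast+
  show "A \<subseteq> clu v" using A v by (auto simp: cluster_def)
qed

lemma cluster_cases: "v \<notin> C \<Longrightarrow> clu v = {} \<or> clu v \<in> tgt \<and> v \<in> vars cs (clu v)"
  using cluster_tight by (fastforce simp: cluster_def)

lemma cluster_subset: "clu v \<subseteq> L"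
  by (auto simp: cluster_def tight_def)

lemma finite_cluster: "finite (clu v)"
  using cluster_subset finite_sub by blast

text \<open>Each of the two clusters is tight and contains both variables, so by maximality each
  contains the other. Hence distinct clusters share no free variable.\<close>

lemma cluster_eq:
  assumes v: "v \<notin> C" and w: "w \<in> vars cs (clu v)" "w \<notin> C"
  shows "clu w = clu v"
proof -
  have "clu v \<noteq> {}" using w by auto
  hence cv: "clu v \<in> tgt" "v \<in> vars cs (clu v)" using cluster_cases[OF v] by auto
  note cw = cluster_tight[OF cv(1) w]
  have "v \<in> vars cs (clu w)" using cv(2) vars_mono[OF cw(3)] by blast
  from cluster_tight(3)[OF cw(1) this v] cw(3) show ?thesis by blast
qed

end

text \<open>
  A set of surplus at most 1 after the conditioning meets the cluster; submodularity then puts it into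
  the cluster. The cluster costs 2 units of slack and brings in the slack of its own constraints.
\<close>

lemma surplus_after_conditioning:
  fixes cs :: "nat \<Rightarrow> 'k::finite constraint" and d a :: real
  assumes "expanding cs t C L s 2"
    and slack: "\<And>A. A \<subseteq> L \<Longrightarrow> A \<noteq> {} \<Longrightarrow> card A \<le> s \<Longrightarrow> real_of_int (surplus cs t C A) \<ge> d * card A - a"
    and v: "v \<notin> C" and E: "E = cluster cs t C L s 2 v" and X: "X = insert v (vars cs E - C)"
    and A: "A \<subseteq> L - E" "A \<noteq> {}" "card A + card E \<le> s"
  shows "surplus cs t (C \<union> X) A \<ge> 2"
    and "real_of_int (surplus cs t (C \<union> X) A) \<ge> d * card A - (a + 2 - d * card E)"
proof -
  interpret expanding cs t C L s 2 by fact
  have AL: "A \<subseteq> L" "card A \<le> s" using A by auto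
  have finA: "finite A" and finE: "finite E" using AL finite_sub finite_cluster E by auto
  have geA: "surplus cs t C A \<ge> 2" using ge[OF AL(1) A(2) AL(2)] .
  have sX: "surplus cs t (C \<union> X) A = surplus cs t C A - int (card (vars cs A \<inter> X - C))"
    by (rule surplus_fix_more[OF finA])
  have "surplus cs t (C \<union> X) A \<ge> 2 \<and>
      real_of_int (surplus cs t (C \<union> X) A) \<ge> d * card A - (a + 2 - d * card E)"
  proof (cases "E = {}")
    case True
    \<comment> \<open>With an empty cluster only \<open>v\<close> becomes fixed, at a cost of at
      most 1. A set of surplus 2 containing \<open>v\<close> would be tight and lie in the empty
      cluster.\<close>
    have not: "v \<notin> vars cs A \<or> surplus cs t C A \<ge> 3"
    proof (rule ccontr)
      assume "\<not> ?thesis"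
      hence "v \<in> vars cs A" "A \<in> tgt" using AL A by (auto simp: tight_def)
      from cluster_tight(3)[OF this(2,1) v] have "A \<subseteq> E" by (simp add: E)
      thus False using A True by auto
    qed
    have "vars cs A \<inter> X - C \<subseteq> {v}" "vars cs A \<inter> X - C = {} \<or> v \<in> vars cs A" using True X by auto
    hence "card (vars cs A \<inter> X - C) \<le> 1" "card (vars cs A \<inter> X - C) = 0 \<or> v \<in> vars cs A"
      using card_mono[of "{v}" "vars cs A \<inter> X - C"] by (simp, metis card.empty)
    thus ?thesis using sX geA slack[OF AL(1) A(2) AL(2)] not True by auto
  next
    case False
    hence Et: "E \<in> tgt" "v \<in> vars cs E" using cluster_cases[OF v] E by auto
    have EA: "E \<inter> A = {}" using A by auto
    let ?h = "int (card (vars cs E \<inter> vars cs A - C))"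
    have "vars cs A \<inter> X - C = vars cs E \<inter> vars cs A - C" using X Et v by auto
    hence sX': "surplus cs t (C \<union> X) A = surplus cs t C A - ?h" using sX by simp
    have "card (vars cs E \<inter> vars cs A - C) \<le> card (vars cs E \<inter> vars cs A)"
      using finE by (intro card_mono) auto
    hence un: "surplus cs t C (E \<union> A) \<le> 2 + surplus cs t C A - 2 * ?h"
      using surplus_Un_disjoint[OF finE finA EA, of cs t C] Et(1) by (auto simp: tight_def)
    have cUn: "card (E \<union> A) = card E + card A" using finE finA EA by (rule card_Un_disjoint)
    have EAL: "E \<union> A \<subseteq> L" "E \<union> A \<noteq> {}" using AL A E cluster_subset by auto
    have c: "card (E \<union> A) \<le> s" using cUn A(3) by simp
    \<comment> \<open>If the surplus of \<open>A\<close> dropped to 1 or less, \<open>A\<close>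
      would share a free variable with \<open>E\<close>, and the union would have surplus at most
      \<open>2 + 1 - ?h \<le> 2\<close>. It would then be tight and contained in
      \<open>E\<close>.\<close>
    have "surplus cs t (C \<union> X) A \<ge> 2"
    proof (rule ccontr)
      assume neg: "\<not> ?thesis"
      hence "?h \<ge> 1" using sX' geA by linarith
      hence "surplus cs t C (E \<union> A) \<le> 2" using neg sX' un by linarith
      hence "E \<union> A \<in> tgt" using EAL c by (auto simp: tight_def)
      moreover have "v \<in> vars cs (E \<union> A)" using Et(2) by (simp add: vars_Un)
      ultimately have "E \<union> A \<subseteq> E" using cluster_tight(3)[OF _ _ v] E by blast
      thus False using EA A(2) by auto
    qed
    moreover have "real_of_int (surplus cs t C (E \<union> A)) \<ge> d * (card E + card A) - a"
      using slack[OF EAL c] cUn by simp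
    moreover have "surplus cs t (C \<union> X) A \<ge> surplus cs t C (E \<union> A) - 2"
      using sX' un by linarith
    ultimately show ?thesis by (simp add: algebra_simps)
  qed
  thus "surplus cs t (C \<union> X) A \<ge> 2"
    "real_of_int (surplus cs t (C \<union> X) A) \<ge> d * card A - (a + 2 - d * card E)" by auto
qed

section \<open>Sampling clusters, and the rounds\<close>

lemma weight_nonneg: "weight \<mu> cs E z \<ge> 0"
  by (simp add: weight_def prod_nonneg)

lemma weight_pos_support:
  assumes "weight \<mu> cs E z > 0" "finite E" "e \<in> E"
  shows "shifted (cs e) z \<in> set_pmf \<mu>"
proof (rule ccontr)
  assume "\<not> ?thesis"
  hence "weight \<mu> cs E z = 0"
    unfolding weight_def using assms(2,3) by (intro prod_zero) (auto simp: set_pmf_iff)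
  thus False using assms(1) by simp
qed

text \<open>Fixing \<open>j\<close> costs one unit of surplus and leaves all surpluses positive, so
  both values of \<open>j\<close> carry the same total mass.\<close>

lemma sum_weight_half:
  fixes \<mu> :: "('k::finite \<Rightarrow> bool) pmf"
  assumes u: "uniform_pmf (t - 1) \<mu>" and fin: "finite E" "finite W" and V: "vars cs E \<subseteq> W \<union> C" "W \<inter> C = {}"
    and pos: "\<And>E'. E' \<subseteq> E \<Longrightarrow> E' \<noteq> {} \<Longrightarrow> surplus cs t C E' \<ge> 2" and j: "j \<in> W"
  shows "(\<Sum>z\<in>agree W \<rho>. weight \<mu> cs E z * of_bool (z j)) = 2 ^ card W / 2"
proof -
  have cW: "card W = Suc (card (W - {j}))" using card_Suc_Diff1[OF fin(2) j] by simp
  have W: "W - (W - {j}) = {j}" using j by auto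
  have "surplus cs t (C \<union> {j}) E' > 0" if "E' \<subseteq> E" "E' \<noteq> {}" for E'
  proof -
    have "finite E'" using that fin finite_subset by blast
    moreover have "card (vars cs E' \<inter> {j} - C) \<le> card {j}" by (intro card_mono) auto
    ultimately show ?thesis using pos[OF that] by (simp add: surplus_fix_more[of E' cs t C "{j}", simplified])
  qed
  hence inner: "(\<Sum>z\<in>agree (W - {j}) y. weight \<mu> cs E z) = 2 ^ card (W - {j})" for y
    using fin V by (intro sum_weight[OF u, of _ _ _ "C \<union> {j}"]) auto
  have "(\<Sum>z\<in>agree W \<rho>. weight \<mu> cs E z * of_bool (z j)) =
      (\<Sum>y\<in>agree {j} \<rho>. \<Sum>z\<in>agree (W - {j}) y. weight \<mu> cs E z * of_bool (z j))"
    using sum_agree_split[OF fin(2), of "W - {j}" "\<lambda>z. weight \<mu> cs E z * of_bool (z j)" \<rho>] W by auto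
  also have "\<dots> = (\<Sum>y\<in>agree {j} \<rho>. \<Sum>z\<in>agree (W - {j}) y. weight \<mu> cs E z * of_bool (y j))"
    by (intro sum.cong refl) (auto simp: agree_def)
  also have "\<dots> = (\<Sum>y\<in>agree {j} \<rho>. 2 ^ card (W - {j}) * of_bool (y j))"
    by (simp add: inner flip: sum_distrib_right)
  also have "\<dots> = 2 ^ card (W - {j})"
  proof -
    have "\<rho>(j := True) \<noteq> \<rho>(j := False)" by (metis fun_upd_same)
    thus ?thesis by (simp add: agree_singleton)
  qed
  finally show ?thesis using cW by simp
qed

text \<open>If \<open>k \<le> t - 1\<close>, uniformity on all positions makes \<open>\<mu>\<close>
  the uniform distribution, whose support contains \<open>f\<close>.\<close>

lemma arity_ge_of_not_trivial:
  fixes \<mu> :: "('k::finite \<Rightarrow> bool) pmf"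
  assumes u: "uniform_pmf (t - 1) \<mu>" and supp: "set_pmf \<mu> \<subseteq> {z. P z}" and f: "\<not> P f"
  shows "t \<le> CARD('k)"
proof (rule ccontr)
  assume "\<not> ?thesis"
  hence "(\<Sum>y\<in>{y. \<forall>i\<in>UNIV. y i = f i}. pmf \<mu> y) = (1 / 2) ^ CARD('k)"
    by (intro uniform_pmf_sum[OF u]) auto
  moreover have "{y. \<forall>i\<in>UNIV. y i = f i} = {f}" by (auto simp: fun_eq_iff)
  ultimately have "f \<in> set_pmf \<mu>" by (simp add: set_pmf_iff)
  thus False using supp f by blast
qed

text \<open>A constraint outside \<open>L\<close> is satisfied by \<open>\<rho>\<close>, so for each
  falsifying \<open>f\<close> some literal equals 1. A constraint in \<open>L\<close> has two free
  variables, because its surplus is at least 2 and \<open>2 k - t \<ge> k\<close>; their literals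
  contribute 1/2 each.\<close>

lemma half_point_in_polytope:
  fixes \<mu> :: "('k::finite \<Rightarrow> bool) pmf" and xs :: "'k constraint list"
  assumes u: "uniform_pmf (t - 1) \<mu>" and supp: "set_pmf \<mu> \<subseteq> {z. P z}"
    and scope: "\<And>e q. e < length xs \<Longrightarrow> snd (xs ! e) q < n"
    and dead: "\<And>e. e < length xs \<Longrightarrow> e \<notin> L \<Longrightarrow> vars ((!) xs) {e} \<subseteq> C \<and> P (shifted (xs ! e) \<rho>)"
    and alive: "\<And>e. e < length xs \<Longrightarrow> e \<in> L \<Longrightarrow> surplus ((!) xs) t C {e} \<ge> 2"
  shows "half_point n C \<rho> \<in> csp_polytope n P (mset xs)"
proof -
  let ?x = "half_point n C \<rho>"
  have "(\<Sum>i\<in>UNIV. literal (?x $ S i) (c i \<noteq> f i)) \<ge> 1" if cS: "(c, S) \<in> set xs" and f: "\<not> P f" for c S f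
  proof -
    obtain e where e: "e < length xs" "xs ! e = (c, S)" using cS by (auto simp: in_set_conv_nth)
    have x: "?x $ S q = (if S q \<in> C then of_bool (\<rho> (S q)) else 1 / 2)" for q
      using scope[OF e(1), of q] e by (simp add: half_point_def)
    have nn: "literal (?x $ S q) b \<ge> 0" for q b by (simp add: x literal_def)
    show ?thesis
    proof (cases "e \<in> L")
      case False
      note d = dead[OF e(1) False]
      hence "shifted (xs ! e) \<rho> \<noteq> f" using f by auto
      then obtain q where q: "(\<rho> (S q) \<noteq> c q) \<noteq> f q" using e by (auto simp: shifted_def fun_eq_iff)
      have "S q \<in> C" using d e by (auto simp: vars_def)
      hence "literal (?x $ S q) (c q \<noteq> f q) = 1" using q by (auto simp: x literal_def)
      moreover have "literal (?x $ S q) (c q \<noteq> f q) \<le> (\<Sum>i\<in>UNIV. literal (?x $ S i) (c i \<noteq> f i))"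
        using nn by (intro member_le_sum) auto
      ultimately show ?thesis by simp
    next
      case True
      let ?V = "range S" and ?Q = "{q. S q \<notin> C}"
      have V: "vars ((!) xs) {e} = ?V" using e by (simp add: vars_def)
      have "card ?V \<le> CARD('k)" by (rule card_image_le) simp
      hence "card (?V - C) \<ge> 2"
        using alive[OF e(1) True] arity_ge_of_not_trivial[OF u supp f] by (simp add: surplus_def V)
      moreover have "?V - C = S ` ?Q" by auto
      ultimately have "card ?Q \<ge> 2" using card_image_le[of ?Q S] by simp
      hence "1 \<le> (\<Sum>q\<in>?Q. (1/2::real))" by simp
      also have "\<dots> = (\<Sum>q\<in>?Q. literal (?x $ S q) (c q \<noteq> f q))"
        by (intro sum.cong) (auto simp: x literal_def)
      also have "\<dots> \<le> (\<Sum>i\<in>UNIV. literal (?x $ S i) (c i \<noteq> f i))"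
        using nn by (intro sum_mono2) auto
      finally show ?thesis .
    qed
  qed
  thus ?thesis by (auto simp: csp_polytope_def half_point_def)
qed

text \<open>The state of the induction: \<open>L\<close> holds the constraints not yet sampled,
  \<open>s\<close> bounds the sizes for which expansion is known, and \<open>a\<close> is the slack
  used so far. A round samples a cluster, which satisfies its own constraints and then leaves
  \<open>L\<close>; constraints outside \<open>L\<close> see only variables whose values are
  kept.\<close>

lemma half_point_in_rounds:
  fixes \<mu> :: "('k::finite \<Rightarrow> bool) pmf" and xs :: "'k constraint list" and d a :: real
  assumes u: "uniform_pmf (t - 1) \<mu>" and supp: "set_pmf \<mu> \<subseteq> {z. P z}"
    and scope: "\<And>e q. e < length xs \<Longrightarrow> snd (xs ! e) q < n" and d: "d > 0"
    and "L \<subseteq> {..<length xs}"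
    and "\<And>e. e < length xs \<Longrightarrow> e \<notin> L \<Longrightarrow> vars ((!) xs) {e} \<subseteq> C \<and> P (shifted (xs ! e) \<rho>)"
    and "\<And>A. A \<subseteq> L \<Longrightarrow> A \<noteq> {} \<Longrightarrow> card A \<le> s \<Longrightarrow> surplus ((!) xs) t C A \<ge> 2"
    and "\<And>A. A \<subseteq> L \<Longrightarrow> A \<noteq> {} \<Longrightarrow> card A \<le> s \<Longrightarrow> real_of_int (surplus ((!) xs) t C A) \<ge> d * card A - a"
    and "a \<ge> 0" and "d * s \<ge> 2 * (2 + a + 2 * r)"
  shows "half_point n C \<rho> \<in> (N_plus n ^^ r) (csp_polytope n P (mset xs))"
  using assms(5-)
proof (induction r arbitrary: C \<rho> L s a)
  case 0
  \<comment> \<open>The size bound must reach single constraints; the last hypothesis gives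
    \<open>d * s \<ge> 4\<close> here.\<close>
  have "s \<ge> 1" using 0(5,6) d by (cases s) auto
  thus ?case using 0 by (auto intro!: half_point_in_polytope[OF u supp scope, of L])
next
  case (Suc r)
  let ?cs = "(!) xs"
  let ?K = "(N_plus n ^^ r) (csp_polytope n P (mset xs))"
  have finL: "finite L" using Suc.prems(1) finite_subset by blast
  \<comment> \<open>A tight set satisfies \<open>d |A| \<le> 2 + a\<close>, which is at most half of
    \<open>d * s\<close>.\<close>
  interpret expanding ?cs t C L s 2
  proof
    fix A assume A: "A \<in> tight ?cs t C L s 2"
    hence "d * card A - a \<le> 2" using Suc.prems(4)[of A] by (force simp: tight_def)
    moreover have "d * real s \<ge> 2 * (2 + a)" using Suc.prems(6) by simp
    ultimately have "d * (2 * card A) \<le> d * s" by simp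
    hence "real (2 * card A) \<le> real s" using d by (subst (asm) mult_le_cancel_left_pos) auto
    thus "2 * card A \<le> s" by linarith
  qed (use finL Suc.prems(3) in auto)
  define E where "E i = clu i" for i
  \<comment> \<open>Inserting \<open>i\<close> covers the case of an empty cluster, where the block
    is \<open>{i}\<close> with a uniform bit.\<close>
  define B where "B i = insert i (vars ?cs (E i) - C)" for i
  define p where "p i z = weight \<mu> ?cs (E i) z / 2 ^ card (B i)" for i z
  have conv: "convex_vec n ?K"
  proof (intro convex_N_plus_funpow convex_csp_polytope)
    fix c S i assume "(c, S) \<in># mset xs"
    then obtain e where "e < length xs" "xs ! e = (c, S)" by (auto simp: in_set_conv_nth)
    thus "S i < n" using scope[of e i] by simp
  qed
  have finE: "finite (E i)" for i by (simp add: E_def finite_cluster)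
  have finB: "finite (B i)" for i by (simp add: B_def E_def finite_cluster)
  have BC: "B i \<inter> C = {}" if "i \<notin> C" for i using that by (auto simp: B_def)
  have VB: "vars ?cs (E i) \<subseteq> B i \<union> C" for i by (auto simp: B_def)
  have cE: "card (E i) \<le> s" "d * card (E i) \<le> 2 + a" if "i \<notin> C" for i
    using cluster_cases[OF that] Suc.prems(5) Suc.prems(4)[of "E i"] by (force simp: E_def tight_def)+
  have pos: "surplus ?cs t C E' \<ge> 2" if "i \<notin> C" "E' \<subseteq> E i" "E' \<noteq> {}" for i E'
  proof (rule Suc.prems(3))
    show "card E' \<le> s" using cE(1)[OF that(1)] card_mono[OF _ that(2)] finite_cluster
      by (metis E_def order_trans)
  qed (use that cluster_subset E_def in auto)
  have eqB: "E j = E i \<and> B j = B i" if "i \<notin> C" "j \<in> B i" for i j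
  proof -
    have "E j = E i" using that cluster_eq[of i j] by (auto simp: B_def E_def)
    moreover have "E i = {} \<or> i \<in> vars ?cs (E i)" using cluster_cases[OF that(1)] by (auto simp: E_def)
    ultimately show ?thesis using that by (auto simp: B_def)
  qed
  have "half_point n C \<rho> \<in> N_plus n ?K"
  proof (rule half_point_in_N_plus[OF conv, where B = B and p = p and Z = "\<lambda>i. agree (B i) \<rho>"])
    show "half_point n C \<rho> \<in> ?K"
      using Suc.prems by (intro Suc.IH[of L C \<rho> s a]) auto
    fix i assume i: "i < n" "i \<notin> C"
    show "i \<in> B i" by (simp add: B_def)
    show "finite (agree (B i) \<rho>)" by (simp add: finB)
    show "sum (p i) (agree (B i) \<rho>) = 1"
    proof -
      have "(\<Sum>z\<in>agree (B i) \<rho>. weight \<mu> ?cs (E i) z) = 2 ^ card (B i)"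
      proof (rule sum_weight[OF u finE finB VB BC[OF i(2)]])
        fix E' assume "E' \<subseteq> E i" "E' \<noteq> {}"
        from pos[OF i(2) this] show "surplus ?cs t C E' > 0" by linarith
      qed
      thus ?thesis by (simp add: p_def flip: sum_divide_distrib)
    qed
    show "j \<notin> C \<and> B j = B i" if "j \<in> B i" for j
      using eqB[OF i(2) that] that BC[OF i(2)] by auto
    show "agree (B j) \<rho> = agree (B i) \<rho> \<and> p j = p i" if "j \<in> B i" for j
      using eqB[OF i(2) that] by (simp add: p_def fun_eq_iff)
    show "(\<Sum>z\<in>agree (B i) \<rho>. p i z * of_bool (z j)) = 1 / 2" if "j \<in> B i" for j
      using sum_weight_half[OF u finE finB VB BC[OF i(2)] pos[OF i(2)] that, where \<rho> = \<rho>]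
      by (simp add: p_def flip: sum_divide_distrib)
    fix z assume z: "z \<in> agree (B i) \<rho>"
    show "p i z \<ge> 0" by (simp add: p_def weight_nonneg)
    show zC: "z j = \<rho> j" if "j \<in> C" for j
      using z that BC[OF i(2)] by (auto simp: agree_def)
    assume "p i z > 0"
    hence wpos: "weight \<mu> ?cs (E i) z > 0" by (simp add: p_def zero_less_divide_iff)
    have slack: "surplus ?cs t (C \<union> B i) A \<ge> 2"
      "real_of_int (surplus ?cs t (C \<union> B i) A) \<ge> d * card A - (a + 2 - d * card (E i))"
      if "A \<subseteq> L - E i" "A \<noteq> {}" "card A \<le> s - card (E i)" for A
      using surplus_after_conditioning[OF expanding_axioms Suc.prems(4) i(2) E_def B_def that(1,2)]
        that(3) cE(1)[OF i(2)] by auto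
    show "half_point n (C \<union> B i) z \<in> ?K"
    proof (rule Suc.IH[of "L - E i" _ _ "s - card (E i)" "a + 2 - d * card (E i)"])
      show "L - E i \<subseteq> {..<length xs}" using Suc.prems(1) by auto
      show "a + 2 - d * card (E i) \<ge> 0" using cE(2)[OF i(2)] by simp
      \<comment> \<open>The 2 added to \<open>a\<close> is paid for by the round just spent;
        otherwise the left side drops by \<open>2 d |E|\<close> and the right side only by
        \<open>d |E|\<close>.\<close>
      show "2 * (2 + (a + 2 - d * card (E i)) + 2 * real r) \<le> d * real (s - card (E i))"
      proof -
        have "d * real (s - card (E i)) = d * s - d * card (E i)"
          using cE(1)[OF i(2)] by (simp add: of_nat_diff right_diff_distrib)
        moreover have "d * card (E i) \<ge> 0" using d by simp
        ultimately show ?thesis using Suc.prems(6) by simp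
      qed
      fix e assume e: "e < length xs" "e \<notin> L - E i"
      show "vars ?cs {e} \<subseteq> C \<union> B i \<and> P (shifted (xs ! e) z)"
      proof (cases "e \<in> L")
        case True
        hence eE: "e \<in> E i" using e by auto
        have "shifted (xs ! e) z \<in> set_pmf \<mu>"
          using weight_pos_support[OF wpos _ eE] finite_cluster by (simp add: E_def)
        moreover have "vars ?cs {e} \<subseteq> vars ?cs (E i)" using eE by (intro vars_mono) auto
        ultimately show ?thesis using supp VB[of i] by blast
      next
        case False
        note dn = Suc.prems(2)[OF e(1) False]
        have "snd (xs ! e) q \<in> C" for q using dn by (auto simp: vars_def)
        hence "shifted (xs ! e) z = shifted (xs ! e) \<rho>" using zC by (simp add: shifted_def)
        thus ?thesis using dn by auto
      qed
    qed (use slack in auto)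
  qed
  thus ?case by simp
qed

text \<open>All sets of surplus 1 are solved in advance, and the rounds start on the rest with
  \<open>a = 0\<close>. The size bound \<open>s0\<close> exceeds \<open>s\<close> by the factor
  \<open>1 + k / d\<close>, because a remaining set is estimated through its union with a set of at
  most \<open>k / d\<close> times its size.\<close>

lemma rounds_nonempty_of_expansion:
  fixes \<mu> :: "('k::finite \<Rightarrow> bool) pmf" and xs :: "'k constraint list" and d :: real
  assumes u: "uniform_pmf (t - 1) \<mu>" and supp: "set_pmf \<mu> \<subseteq> {z. P z}"
    and scope: "\<And>e q. e < length xs \<Longrightarrow> snd (xs ! e) q < n" and d: "d > 0"
    and expan: "\<And>A. A \<subseteq> {..<length xs} \<Longrightarrow> card A \<le> s0 \<Longrightarrow> real_of_int (surplus ((!) xs) t {} A) \<ge> d * card A"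
    and s0: "d * s0 \<ge> 2" "real s0 \<ge> real s * (1 + CARD('k) / d)" and s: "d * s \<ge> 4 + 4 * real r"
  shows "(N_plus n ^^ r) (csp_polytope n P (mset xs)) \<noteq> {}"
proof -
  let ?cs = "(!) xs"
  let ?I = "{..<length xs}"
  have expan1: "surplus ?cs t {} A \<ge> 1" if "A \<subseteq> ?I" "A \<noteq> {}" "card A \<le> s0" for A
  proof -
    have "card A > 0" using that finite_subset by (auto simp: card_gt_0_iff)
    hence "d * card A > 0" using d by simp
    thus ?thesis using expan[OF that(1,3)] by linarith
  qed
  have szd: "d * card A \<le> 1" if "A \<in> tight ?cs t {} ?I s0 1" for A
    using expan[of A] that by (force simp: tight_def)
  interpret expanding ?cs t "{}" ?I s0 1
  proof
    fix A assume "A \<in> tight ?cs t {} ?I s0 1"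
    from szd[OF this] have "d * (2 * card A) \<le> d * s0" using s0(1) by simp
    hence "real (2 * card A) \<le> real s0" using d by (subst (asm) mult_le_cancel_left_pos) auto
    thus "2 * card A \<le> s0" by linarith
  qed (use expan1 in auto)
  define D where "D = \<Union>tgt"
  define C where "C = vars ?cs D"
  have DI: "D \<subseteq> ?I" by (auto simp: D_def tight_def)
  have "\<exists>z. weight \<mu> ?cs A z > 0" if A: "A \<in> tgt" for A
  proof (rule ccontr)
    assume "\<not> ?thesis"
    hence "weight \<mu> ?cs A z = 0" for z using weight_nonneg[of \<mu> ?cs A z] by (metis less_eq_real_def)
    moreover have fin: "finite A" using A by (auto simp: tight_def intro: finite_sub)
    moreover have "(\<Sum>z\<in>agree (vars ?cs A) undefined. weight \<mu> ?cs A z) = 2 ^ card (vars ?cs A)"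
    proof (rule sum_weight[OF u, where C = "{}"])
      fix E' assume "E' \<subseteq> A" "E' \<noteq> {}"
      moreover have "card E' \<le> card A" using fin \<open>E' \<subseteq> A\<close> by (rule card_mono)
      ultimately show "surplus ?cs t {} E' > 0"
        using expan1[of E'] A by (force simp: tight_def)
    qed (use fin in auto)
    ultimately show False by simp
  qed
  then obtain zs where zs: "\<And>A. A \<in> tgt \<Longrightarrow> weight \<mu> ?cs A (zs A) > 0" by metis
  \<comment> \<open>Nothing is fixed yet, so the clusters have disjoint variable sets and their
    solutions can be glued.\<close>
  define \<rho> where "\<rho> v = zs (clu v) v" for v
  have doneD: "P (shifted (xs ! e) \<rho>)" if eD: "e \<in> D" for e
  proof -
    obtain A where A: "A \<in> tgt" "e \<in> A" using eD by (auto simp: D_def)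
    let ?S = "snd (xs ! e)"
    \<comment> \<open>The position \<open>undefined\<close> is an arbitrary choice: all variables of
      \<open>e\<close> have the same cluster.\<close>
    define E where "E = clu (?S undefined)"
    have SA: "?S q \<in> vars ?cs A" for q using scope_in_vars[OF A(2), of ?cs] .
    have E: "E \<in> tgt" "e \<in> E" using cluster_tight[OF A(1) SA] A(2) by (auto simp: E_def)
    have "clu (?S q) = E" for q
      using cluster_eq[of "?S undefined" "?S q"] scope_in_vars[OF E(2), of ?cs q] by (simp add: E_def)
    hence "shifted (xs ! e) \<rho> = shifted (xs ! e) (zs E)" by (simp add: shifted_def \<rho>_def)
    moreover have "shifted (xs ! e) (zs E) \<in> set_pmf \<mu>"
      using E by (intro weight_pos_support[OF zs]) (auto simp: tight_def intro: finite_sub)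
    ultimately show ?thesis using supp by auto
  qed
  \<comment> \<open>A variable fixed initially is paid for by a set of surplus 1, which is exactly what fixing it
    subtracts from the surplus of a set containing it.\<close>
  have cover: "\<exists>U\<subseteq>D. X \<subseteq> vars ?cs U \<and> surplus ?cs t {} U \<le> card X \<and> d * card U \<le> card X"
    if "finite X" "X \<subseteq> C" for X
    using that
  proof (induction X rule: finite_induct)
    case empty
    show ?case by (intro exI[of _ "{}"]) auto
  next
    case (insert v X)
    then obtain U where U: "U \<subseteq> D" "X \<subseteq> vars ?cs U" "surplus ?cs t {} U \<le> card X" "d * card U \<le> card X"
      by auto
    obtain A where A: "A \<in> tgt" "v \<in> vars ?cs A"
      using insert.prems by (auto simp: C_def D_def vars_def)
    have fin: "finite U" "finite A"
      using finite_sub[OF order_trans[OF U(1) DI]] A(1) by (auto simp: tight_def intro: finite_sub)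
    have "card (U \<inter> A) \<le> card A" using fin by (intro card_mono) auto
    hence "surplus ?cs t {} (U \<inter> A) \<ge> 0"
      using expan1[of "U \<inter> A"] A by (cases "U \<inter> A = {}") (force simp: tight_def)+
    hence "surplus ?cs t {} (U \<union> A) \<le> card X + 1"
      using surplus_submodular[OF fin, of ?cs t "{}"] U(3) A(1) by (simp add: tight_def)
    moreover have "d * card (U \<union> A) \<le> d * (card U + card A)"
      using card_Un_le[of U A] d by simp
    moreover have "d * (card U + card A) \<le> card X + 1"
      using U(4) szd[OF A(1)] by (simp add: distrib_left)
    ultimately show ?case using U A insert
      by (intro exI[of _ "U \<union> A"]) (auto simp: vars_Un D_def)
  qed
  have ext: "real_of_int (surplus ?cs t C E) \<ge> d * card E \<and> surplus ?cs t C E \<ge> 2"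
    if E: "E \<subseteq> ?I - D" "E \<noteq> {}" "card E \<le> s" for E
  proof -
    define X where "X = vars ?cs E \<inter> C"
    have finE: "finite E" using finite_sub[of E] E(1) by auto
    have finX: "finite X" by (simp add: X_def finE)
    obtain U where U: "U \<subseteq> D" "X \<subseteq> vars ?cs U" "surplus ?cs t {} U \<le> card X" "d * card U \<le> card X"
      using cover[OF finX] by (auto simp: X_def)
    have finU: "finite U" using finite_sub[OF order_trans[OF U(1) DI]] .
    have EU: "E \<inter> U = {}" using E U by auto
    have "vars ?cs E \<inter> vars ?cs U = X"
      using U(2) vars_mono[OF U(1), of ?cs] by (auto simp: X_def C_def)
    hence "surplus ?cs t {} (E \<union> U) = surplus ?cs t {} E + surplus ?cs t {} U - 2 * card X"
      using surplus_Un_disjoint[OF finE finU EU, of ?cs t "{}"] by simp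
    moreover have "surplus ?cs t C E = surplus ?cs t {} E - card X"
      using surplus_fix_more[OF finE, of ?cs t "{}" C] by (simp add: X_def)
    ultimately have key: "surplus ?cs t {} (E \<union> U) \<le> surplus ?cs t C E" using U(3) by simp
    have "card X \<le> card (vars ?cs E)" using finE by (intro card_mono) (auto simp: X_def)
    also have "\<dots> \<le> (\<Sum>e\<in>E. card (range (snd (xs ! e))))" unfolding vars_def using finE by (rule card_UN_le)
    also have "\<dots> \<le> (\<Sum>e\<in>E. CARD('k))" by (intro sum_mono card_image_le) simp
    finally have cX: "card X \<le> card E * CARD('k)" by simp
    have "d * card U \<le> card E * CARD('k)" using U(4) cX by (metis of_nat_le_iff order_trans)
    hence "card U \<le> card E * (CARD('k) / d)" using d by (simp add: field_simps)
    hence "card (E \<union> U) \<le> card E * (1 + CARD('k) / d)"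
      using finE finU EU by (simp add: card_Un_disjoint distrib_left)
    also have "\<dots> \<le> s * (1 + CARD('k) / d)" using E(3) d by (intro mult_right_mono) auto
    also have "\<dots> \<le> s0" by (rule s0(2))
    finally have cEU: "card (E \<union> U) \<le> s0" by simp
    have EUI: "E \<union> U \<subseteq> ?I" using E U DI by auto
    \<comment> \<open>Otherwise \<open>E \<union> U\<close> would be a tight set and
      \<open>E\<close> part of \<open>D\<close>.\<close>
    have "surplus ?cs t C E \<ge> 2"
    proof (rule ccontr)
      assume "\<not> ?thesis"
      hence "E \<union> U \<in> tgt" using key EUI E(2) cEU by (auto simp: tight_def)
      hence "E \<subseteq> D" by (auto simp: D_def)
      thus False using E by auto
    qed
    moreover have "card E \<le> card (E \<union> U)" using finE finU by (intro card_mono) auto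
    hence "d * card E \<le> d * card (E \<union> U)" using d by simp
    ultimately show ?thesis using expan[OF EUI cEU] key by linarith
  qed
  have "half_point n C \<rho> \<in> (N_plus n ^^ r) (csp_polytope n P (mset xs))"
  proof (rule half_point_in_rounds[OF u supp scope d, of "?I - D" C \<rho> s 0])
    fix e assume "e < length xs" "e \<notin> ?I - D"
    hence "e \<in> D" by auto
    thus "vars ?cs {e} \<subseteq> C \<and> P (shifted (xs ! e) \<rho>)"
      using doneD vars_mono[of "{e}" D ?cs] by (auto simp: C_def)
  qed (use ext s in auto)
  thus ?thesis by blast
qed

section \<open>Expansion of random instances\<close>

text \<open>One draw \<open>y\<close> adds a collision exactly if it hits \<open>V\<close> or an
  earlier value.\<close>

lemma card_image_insert_fun_upd:
  assumes "finite A" "finite V" "a \<notin> A"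
  shows "Suc (card A) - card ((S(a := y)) ` insert a A - V) =
    (if y \<in> V \<union> S ` A then Suc (card A - card (S ` A - V)) else card A - card (S ` A - V))"
proof -
  have im: "(S(a := y)) ` insert a A = insert y (S ` A)" using assms(3) by auto
  have "card (S ` A - V) \<le> card (S ` A)" using assms by (intro card_mono) auto
  also have "\<dots> \<le> card A" using assms by (intro card_image_le)
  finally have le: "card (S ` A - V) \<le> card A" .
  show ?thesis
  proof (cases "y \<in> V \<union> S ` A")
    case True
    hence "insert y (S ` A) - V = S ` A - V" by auto
    thus ?thesis unfolding im using True le by (simp add: Suc_diff_le)
  next
    case False
    hence "card (insert y (S ` A) - V) = Suc (card (S ` A - V))"
      using assms by (simp add: insert_Diff_if)
    thus ?thesis unfolding im using False by simp
  qed
qed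

text \<open>
  The exponent counts the positions that hit \<open>V\<close> or repeat an earlier position; drawing the positions
  one after the other, each does so for at most \<open>R\<close> of its \<open>n\<close> values.
\<close>

lemma sum_PiE_collisions:
  fixes x :: real and n :: nat
  assumes "finite A" "x \<ge> 0" "finite V" "card V + card A \<le> R"
  shows "(\<Sum>S\<in>Pi\<^sub>E A (\<lambda>_. {..<n}). x ^ (card A - card (S ` A - V))) \<le> (real n + x * R) ^ card A"
  using assms
proof (induction A rule: finite_induct)
  case (insert a A)
  let ?F = "Pi\<^sub>E A (\<lambda>_. {..<n::nat})"
  let ?e = "\<lambda>S :: 'a \<Rightarrow> nat. card A - card (S ` A - V)"
  have "(\<Sum>S\<in>Pi\<^sub>E (insert a A) (\<lambda>_. {..<n}). x ^ (card (insert a A) - card (S ` insert a A - V)))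
      = (\<Sum>(y, S)\<in>{..<n} \<times> ?F. x ^ (Suc (card A) - card ((S(a := y)) ` insert a A - V)))"
    using insert.hyps unfolding PiE_insert_eq
    by (subst sum.reindex[OF inj_combinator]) (auto simp: case_prod_beta simp del: fun_upd_apply)
  also have "\<dots> = (\<Sum>S\<in>?F. \<Sum>y<n. x ^ (Suc (card A) - card ((S(a := y)) ` insert a A - V)))"
    by (subst sum.cartesian_product[symmetric]) (rule sum.swap)
  also have "\<dots> \<le> (\<Sum>S\<in>?F. x ^ ?e S * (n + x * R))"
  proof (rule sum_mono)
    fix S assume "S \<in> ?F"
    let ?U = "V \<union> S ` A"
    have "card ?U \<le> card V + card (S ` A)" by (rule card_Un_le)
    also have "\<dots> \<le> R" using card_image_le[OF insert.hyps(1), of S] insert by simp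
    finally have cU: "card ?U \<le> R" .
    have "(\<Sum>y<n. x ^ (Suc (card A) - card ((S(a := y)) ` insert a A - V)))
        = (\<Sum>y<n. if y \<in> ?U then x * x ^ ?e S else x ^ ?e S)"
      unfolding card_image_insert_fun_upd[OF insert.hyps(1) insert.prems(2) insert.hyps(2)]
      by (intro sum.cong) simp_all
    also have "\<dots> \<le> (\<Sum>y<n. (if y \<in> ?U then x * x ^ ?e S else 0) + x ^ ?e S)"
      using insert.prems by (intro sum_mono) auto
    also have "\<dots> = card ({..<n} \<inter> ?U) * (x * x ^ ?e S) + n * x ^ ?e S"
      by (simp add: sum.distrib sum.If_cases flip: Un_def)
    also have "\<dots> \<le> R * (x * x ^ ?e S) + n * x ^ ?e S"
    proof -
      have "card ({..<n} \<inter> ?U) \<le> card ?U" using insert by (intro card_mono) auto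
      hence "card ({..<n} \<inter> ?U) \<le> R" using cU by simp
      thus ?thesis using insert.prems by (intro add_right_mono mult_right_mono) auto
    qed
    finally show "(\<Sum>y<n. x ^ (Suc (card A) - card ((S(a := y)) ` insert a A - V))) \<le> x ^ ?e S * (n + x * R)"
      by (simp add: algebra_simps)
  qed
  also have "\<dots> = (\<Sum>S\<in>?F. x ^ ?e S) * (n + x * R)" by (simp add: sum_distrib_right)
  also have "\<dots> \<le> (n + x * R) ^ card A * (n + x * R)"
    using insert by (intro mult_right_mono insert.IH) auto
  finally show ?case using insert.hyps by (simp add: mult.commute)
qed simp

section \<open>Collision moments of random constraints\<close>

lemma constraints_eq: "constraints n = UNIV \<times> Pi\<^sub>E UNIV (\<lambda>_. {..<n})"
  by (auto simp: constraints_def PiE_def)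

lemma finite_constraints: "finite (constraints n :: 'k::finite constraint set)"
  unfolding constraints_eq by (intro finite_cartesian_product finite_PiE) auto

lemma card_constraints: "card (constraints n :: 'k::finite constraint set) = 2 ^ CARD('k) * n ^ CARD('k)"
  by (simp add: constraints_eq card_cartesian_product card_funcsetE card_fun)

lemma constraints_nonempty: "n > 0 \<Longrightarrow> (constraints n :: 'k::finite constraint set) \<noteq> {}"
  using card_constraints[where 'k='k, of n] by auto

lemma nn_integral_constraint_collisions:
  fixes V :: "nat set"
  assumes n: "n > 0" and x: "x \<ge> 0" and V: "finite V" "card V + CARD('k::finite) \<le> R"
  shows "(\<integral>\<^sup>+e. ennreal (x ^ (CARD('k) - card (range (snd e) - V))) \<partial>pmf_of_set (constraints n :: 'k constraint set))
    \<le> ennreal ((1 + x * R / n) ^ CARD('k))"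
proof -
  let ?A = "constraints n :: 'k constraint set"
  let ?f = "\<lambda>S :: 'k \<Rightarrow> nat. x ^ (CARD('k) - card (range S - V))"
  have "(\<Sum>e\<in>?A. ?f (snd e)) = 2 ^ CARD('k) * (\<Sum>S\<in>Pi\<^sub>E UNIV (\<lambda>_. {..<n}). ?f S)"
    unfolding constraints_eq by (subst sum.cartesian_product') (simp add: card_fun)
  also have "\<dots> \<le> 2 ^ CARD('k) * (n + x * R) ^ CARD('k)"
    using sum_PiE_collisions[of "UNIV :: 'k set" x V R n] x V by simp
  finally have "(\<Sum>e\<in>?A. ?f (snd e)) / card ?A \<le> 2 ^ CARD('k) * (n + x * R) ^ CARD('k) / card ?A"
    by (intro divide_right_mono) auto
  also have "\<dots> = ((n + x * R) / n) ^ CARD('k)" by (simp add: card_constraints power_divide)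
  also have "(n + x * R) / n = 1 + x * R / n" using n by (simp add: field_simps)
  finally have le: "(\<Sum>e\<in>?A. ?f (snd e)) / card ?A \<le> (1 + x * R / n) ^ CARD('k)" .
  have "(\<integral>\<^sup>+e. ennreal (?f (snd e)) \<partial>pmf_of_set ?A) = (\<Sum>e\<in>?A. ennreal (?f (snd e))) / card ?A"
    using n by (intro nn_integral_pmf_of_set constraints_nonempty finite_constraints)
  also have "\<dots> = ennreal ((\<Sum>e\<in>?A. ?f (snd e)) / card ?A)"
    using x n by (subst sum_ennreal) (auto simp: divide_ennreal sum_nonneg card_constraints ennreal_of_nat_eq_real_of_nat)
  also have "\<dots> \<le> ennreal ((1 + x * R / n) ^ CARD('k))" using le by (rule ennreal_leI)
  finally show ?thesis .
qed

definition scopes :: "'k::finite constraint list \<Rightarrow> nat set" where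
  "scopes ys = (\<Union>e\<in>set ys. range (snd e))"

lemma card_scopes_le: "card (scopes (ys :: 'k::finite constraint list)) \<le> CARD('k) * length ys"
proof (induction ys)
  case (Cons e ys)
  have "card (scopes (e # ys)) \<le> card (range (snd e)) + card (scopes ys)"
    unfolding scopes_def using card_Un_le by simp
  also have "card (range (snd e)) \<le> CARD('k)" by (rule card_image_le) simp
  finally show ?case using Cons by simp
qed (simp add: scopes_def)

lemma finite_scopes [simp]: "finite (scopes ys)"
  by (simp add: scopes_def)

text \<open>Collisions add up along the list. Given the earlier constraints, the next one
  contributes at most the factor for \<open>V\<close> equal to their variables, and \<open>R\<close>
  bounds the number of variables throughout.\<close>

lemma nn_integral_list_collisions:
  assumes n: "n > 0" and x: "x \<ge> 0" and R: "CARD('k::finite) * j \<le> R"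
  shows "(\<integral>\<^sup>+ys. ennreal (x ^ (CARD('k) * j - card (scopes ys))) \<partial>replicate_pmf j (pmf_of_set (constraints n :: 'k constraint set)))
    \<le> ennreal ((1 + x * R / n) ^ (CARD('k) * j))"
  using R
proof (induction j)
  case (Suc j)
  let ?p = "pmf_of_set (constraints n :: 'k constraint set)"
  let ?B = "1 + x * R / n"
  have B: "?B \<ge> 0" using x by simp
  have step: "(\<integral>\<^sup>+e. ennreal (x ^ (CARD('k) * Suc j - card (scopes (e # ys)))) \<partial>?p)
      \<le> ennreal (x ^ (CARD('k) * j - card (scopes ys))) * ennreal (?B ^ CARD('k))"
    if "length ys = j" for ys :: "'k constraint list"
  proof -
    have le: "card (scopes ys) \<le> CARD('k) * j" using card_scopes_le[of ys] that by simp
    have eq: "CARD('k) * Suc j - card (scopes (e # ys)) =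
        (CARD('k) * j - card (scopes ys)) + (CARD('k) - card (range (snd e) - scopes ys))" for e
    proof -
      have "scopes (e # ys) = scopes ys \<union> (range (snd e) - scopes ys)" by (auto simp: scopes_def)
      hence "card (scopes (e # ys)) = card (scopes ys) + card (range (snd e) - scopes ys)"
        by (metis Diff_disjoint card_Un_disjoint finite_Diff finite_code finite_imageI finite_scopes)
      moreover have "card (range (snd e) - scopes ys) \<le> CARD('k)"
        using card_mono[of "range (snd e)" "range (snd e) - scopes ys"] card_image_le[of UNIV "snd e"]
        by (metis Diff_subset finite finite_imageI le_trans)
      ultimately show ?thesis using le by simp
    qed
    have "(\<integral>\<^sup>+e. ennreal (x ^ (CARD('k) * Suc j - card (scopes (e # ys)))) \<partial>?p)
       = (\<integral>\<^sup>+e. ennreal (x ^ (CARD('k) * j - card (scopes ys))) *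
            ennreal (x ^ (CARD('k) - card (range (snd e) - scopes ys))) \<partial>?p)"
      unfolding eq power_add using x by (simp add: ennreal_mult)
    also have "\<dots> = ennreal (x ^ (CARD('k) * j - card (scopes ys))) *
        (\<integral>\<^sup>+e. ennreal (x ^ (CARD('k) - card (range (snd e) - scopes ys))) \<partial>?p)"
      by (rule nn_integral_cmult) simp
    also have "\<dots> \<le> ennreal (x ^ (CARD('k) * j - card (scopes ys))) * ennreal (?B ^ CARD('k))"
      using le Suc.prems by (intro mult_left_mono nn_integral_constraint_collisions n x) auto
    finally show ?thesis .
  qed
  \<comment> \<open>Commuting the draws makes the head of the list the last one drawn, so that one
    can condition on the tail.\<close>
  have "replicate_pmf (Suc j) ?p = bind_pmf (replicate_pmf j ?p) (\<lambda>ys. bind_pmf ?p (\<lambda>e. return_pmf (e # ys)))"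
    by (simp add: bind_commute_pmf[of ?p])
  hence "(\<integral>\<^sup>+ys. ennreal (x ^ (CARD('k) * Suc j - card (scopes ys))) \<partial>replicate_pmf (Suc j) ?p)
     = (\<integral>\<^sup>+ys. (\<integral>\<^sup>+e. ennreal (x ^ (CARD('k) * Suc j - card (scopes (e # ys)))) \<partial>?p) \<partial>replicate_pmf j ?p)"
    by (simp del: replicate_pmf.simps mult_Suc_right)
  also have "\<dots> \<le> (\<integral>\<^sup>+ys. ennreal (x ^ (CARD('k) * j - card (scopes ys))) * ennreal (?B ^ CARD('k)) \<partial>replicate_pmf j ?p)"
    by (rule nn_integral_mono_AE) (auto simp: AE_measure_pmf_iff set_replicate_pmf intro!: step simp del: mult_Suc_right)
  also have "\<dots> = (\<integral>\<^sup>+ys. ennreal (x ^ (CARD('k) * j - card (scopes ys))) \<partial>replicate_pmf j ?p) * ennreal (?B ^ CARD('k))"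
    by (rule nn_integral_multc) simp
  also have "\<dots> \<le> ennreal (?B ^ (CARD('k) * j)) * ennreal (?B ^ CARD('k))"
    using Suc.prems by (intro mult_right_mono Suc.IH) auto
  also have "\<dots> = ennreal (?B ^ (CARD('k) * Suc j))"
    using B by (simp add: power_add mult.commute flip: ennreal_mult)
  finally show ?case .
qed simp

text \<open>This transfers the moment bound for lists to the constraints at a fixed set of
  positions.\<close>

lemma nths_replicate_pmf:
  "J \<subseteq> {..<m} \<Longrightarrow> map_pmf (\<lambda>xs. nths xs J) (replicate_pmf m p) = replicate_pmf (card J) p"
proof (induction m arbitrary: J)
  case 0
  thus ?case by simp
next
  case (Suc m)
  let ?J = "{j. Suc j \<in> J}"
  have J': "?J \<subseteq> {..<m}" using Suc.prems by auto
  have fin: "finite J" "finite ?J" using Suc.prems J' finite_subset by blast+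
  have img: "J - {0} = Suc ` ?J" by (auto simp: image_iff) (metis not0_implies_Suc)
  have cJ: "card ?J = card (J - {0})" unfolding img by (simp add: card_image)
  have IH: "map_pmf (\<lambda>xs. nths xs ?J) (replicate_pmf m p) = replicate_pmf (card ?J) p"
    by (rule Suc.IH[OF J'])
  have rep: "map_pmf (\<lambda>xs. nths xs J) (replicate_pmf (Suc m) p) =
      bind_pmf p (\<lambda>x. map_pmf (\<lambda>ys. nths (x # ys) J) (replicate_pmf m p))"
    by (simp add: map_pmf_def bind_assoc_pmf bind_return_pmf)
  show ?case
  proof (cases "0 \<in> J")
    case True
    hence "card J = Suc (card ?J)" using fin cJ by (metis card_Suc_Diff1)
    moreover have "map_pmf (\<lambda>ys. nths (x # ys) J) (replicate_pmf m p) =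
        map_pmf ((#) x) (replicate_pmf (card ?J) p)" for x
      unfolding IH[symmetric] using True by (simp add: nths_Cons pmf.map_comp comp_def)
    ultimately show ?thesis unfolding rep by (simp add: map_pmf_def)
  next
    case False
    hence "card J = card ?J" using cJ by simp
    thus ?thesis unfolding rep using False IH by (simp add: nths_Cons)
  qed
qed

text \<open>With nothing fixed, surplus below \<open>d j\<close> means that the \<open>k j\<close>
  scope positions have more than \<open>(t - d) j / 2\<close> collisions. The bound is the Markov
  inequality for \<open>x\<close> raised to the number of collisions; for \<open>k j > n\<close> it
  exceeds 1 anyway.\<close>

lemma prob_not_expanding:
  fixes d :: real
  assumes n: "n > 0" and J: "J \<subseteq> {..<m}" "J \<noteq> {}" and d: "d \<le> t"
  defines "k \<equiv> CARD('k::finite)" and "j \<equiv> card J"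
  shows "measure_pmf.prob (replicate_pmf m (pmf_of_set (constraints n :: 'k constraint set)))
      {xs. real_of_int (surplus ((!) xs) t {} J) < d * j}
    \<le> 2 ^ (k * j) * (real (k * j) / n) powr ((t - d) / 2 * j)"
proof (cases "k * j \<le> n")
  case False
  have "real n \<le> real (k * j)" using False by (intro of_nat_mono) simp
  hence "real (k * j) / n \<ge> 1" using n by (simp del: of_nat_mult)
  hence "(real (k * j) / n) powr ((t - d) / 2 * j) \<ge> 1"
    using d by (intro ge_one_powr_ge_zero) auto
  hence "(1::real) * 1 \<le> 2 ^ (k * j) * (real (k * j) / n) powr ((t - d) / 2 * j)"
    by (intro mult_mono) auto
  thus ?thesis by (intro order_trans[OF measure_pmf.prob_le_1]) simp
next
  case True
  let ?p = "pmf_of_set (constraints n :: 'k constraint set)"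
  let ?w = "(t - d) / 2 * j"
  have finJ: "finite J" using J finite_subset by blast
  have j: "j > 0" using J finJ by (auto simp: j_def card_gt_0_iff)
  have k: "k > 0" by (simp add: k_def)
  \<comment> \<open>Makes the factor \<open>1 + x k j / n\<close> of the moment bound equal to 2.\<close>
  define x where "x = real n / (k * j)"
  have x1: "x \<ge> 1" using True j k by (simp add: x_def field_simps flip: of_nat_mult)
  define X where "X = {ys :: 'k constraint list. length ys = j \<and> real (k * j - card (scopes ys)) > ?w}"
  have "measure_pmf.prob (replicate_pmf m ?p) {xs. real_of_int (surplus ((!) xs) t {} J) < d * j}
     \<le> measure_pmf.prob (replicate_pmf m ?p) ((\<lambda>xs. nths xs J) -` X)"
  proof (rule measure_pmf.finite_measure_mono_AE)
    show "AE xs in replicate_pmf m ?p. xs \<in> {xs. real_of_int (surplus ((!) xs) t {} J) < d * j} \<longrightarrow>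
        xs \<in> (\<lambda>xs. nths xs J) -` X"
      unfolding AE_measure_pmf_iff
    proof (intro ballI impI)
      fix xs assume "xs \<in> set_pmf (replicate_pmf m ?p)"
        and bad: "xs \<in> {xs. real_of_int (surplus ((!) xs) t {} J) < d * j}"
      hence len: "length xs = m" by (auto simp: set_replicate_pmf)
      have "{i. i < length xs \<and> i \<in> J} = J" using J len by auto
      hence ln: "length (nths xs J) = j" by (simp add: length_nths j_def)
      have v: "vars ((!) xs) J = scopes (nths xs J)"
      proof -
        have "{xs ! i |i. i < length xs \<and> i \<in> J} = (!) xs ` J" using J len by auto
        thus ?thesis by (simp add: vars_def scopes_def set_nths)
      qed
      have le: "card (scopes (nths xs J)) \<le> k * j" using card_scopes_le[of "nths xs J"] ln by (simp add: k_def)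
      have "real_of_int (surplus ((!) xs) t {} J) = 2 * real (card (scopes (nths xs J))) - (2 * real k - real t) * real j"
        by (simp add: surplus_def v j_def k_def)
      hence "real (k * j - card (scopes (nths xs J))) > ?w"
        using bad le by (simp add: of_nat_diff field_simps)
      thus "xs \<in> (\<lambda>xs. nths xs J) -` X" using ln by (simp add: X_def)
    qed
  qed simp
  also have "\<dots> = measure_pmf.prob (replicate_pmf j ?p) X"
    using nths_replicate_pmf[OF J(1), of ?p] by (simp add: j_def flip: measure_map_pmf)
  also have "\<dots> \<le> 2 ^ (k * j) / x powr ?w"
  proof -
    let ?c = "ennreal (1 / x powr ?w)"
    let ?u = "\<lambda>ys :: 'k constraint list. ennreal (x ^ (k * j - card (scopes ys)))"
    have "emeasure (replicate_pmf j ?p) X \<le> emeasure (replicate_pmf j ?p) {ys \<in> UNIV. 1 \<le> ?c * ?u ys}"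
    proof (rule emeasure_mono)
      show "X \<subseteq> {ys \<in> UNIV. 1 \<le> ?c * ?u ys}"
      proof
        fix ys assume "ys \<in> X"
        hence "x powr ?w \<le> x powr (k * j - card (scopes ys))"
          using x1 by (intro powr_mono) (auto simp: X_def)
        also have "\<dots> = x ^ (k * j - card (scopes ys))" using x1 by (simp add: powr_realpow)
        finally have "1 \<le> 1 / x powr ?w * x ^ (k * j - card (scopes ys))"
          using x1 by (simp add: field_simps)
        thus "ys \<in> {ys \<in> UNIV. 1 \<le> ?c * ?u ys}"
          using x1 by (simp flip: ennreal_mult ennreal_1)
      qed
    qed simp
    also have "\<dots> \<le> ?c * (\<integral>\<^sup>+ys. ?u ys * indicator UNIV ys \<partial>replicate_pmf j ?p)"
      by (rule nn_integral_Markov_inequality) auto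
    also have "\<dots> \<le> ?c * ennreal ((1 + x * (k * j) / n) ^ (k * j))"
      using nn_integral_list_collisions[OF n, of x j "k * j", where 'k='k] x1
      by (intro mult_left_mono) (auto simp: k_def)
    also have "x * (k * j) / n = 1" using n j k by (simp add: x_def)
    also have "?c * ennreal ((1 + 1) ^ (k * j)) = ennreal (2 ^ (k * j) / x powr ?w)"
      by (simp flip: ennreal_mult)
    finally show ?thesis by (simp add: measure_pmf.emeasure_eq_measure)
  qed
  also have "\<dots> = 2 ^ (k * j) * (real (k * j) / n) powr ?w"
    using n j k by (simp add: x_def powr_divide)
  finally show ?thesis .
qed

section \<open>Union bound and choice of parameters\<close>

lemma self_power_le_exp_fact: "real j ^ j \<le> exp j * fact j"
proof -
  \<comment> \<open>A single term of the exponential series at \<open>j\<close>.\<close>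
  have "(\<Sum>i\<in>{j}. real j ^ i /\<^sub>R fact i) \<le> (\<Sum>i. real j ^ i /\<^sub>R fact i)"
    using summable_exp_generic[of "real j"] by (intro sum_le_suminf) auto
  thus ?thesis by (simp add: exp_def field_simps)
qed

lemma binomial_le_exp:
  assumes "j > 0"
  shows "real (m choose j) \<le> (exp 1 * m / j) ^ j"
proof -
  have "real (m choose j) * fact j \<le> real m ^ j"
    using binomial_fact_pow[of m j] by (metis of_nat_fact of_nat_le_iff of_nat_mult of_nat_power)
  hence "real (m choose j) * fact j * (exp j * real j ^ j) \<le> real m ^ j * (exp j * real j ^ j)"
    by (intro mult_right_mono) auto
  also have "\<dots> \<le> real m ^ j * (exp j * (exp j * fact j))"
    using self_power_le_exp_fact by (intro mult_left_mono) auto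
  finally have "real (m choose j) * real j ^ j \<le> real m ^ j * exp j" by simp
  thus ?thesis using assms by (simp add: power_divide power_mult_distrib field_simps flip: exp_of_nat_mult)
qed

text \<open>Union bound over the sets of each size \<open>j\<close>. Since
  \<open>(t - d) / 2 \<ge> 1\<close>, the base of the \<open>j\<close>-th power grows with
  \<open>j\<close>, so it is at most \<open>Q\<close>, its value at size \<open>s\<close>; the
  geometric series then sums to at most \<open>2 * Q\<close>.\<close>

lemma prob_some_not_expanding:
  fixes d Q :: real and m n s t :: nat
  assumes n: "n > 0" and d: "d \<le> real t - 2"
  defines "k \<equiv> CARD('k::finite)"
  defines "Q \<equiv> exp 1 * m * 2 ^ k * k powr ((t - d) / 2) * s powr ((t - d) / 2 - 1) * n powr (- ((t - d) / 2))"
  assumes Q: "Q \<le> 1 / 2"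
  shows "measure_pmf.prob (replicate_pmf m (pmf_of_set (constraints n :: 'k constraint set)))
      {xs. \<exists>J\<subseteq>{..<m}. J \<noteq> {} \<and> card J \<le> s \<and> real_of_int (surplus ((!) xs) t {} J) < d * card J} \<le> 2 * Q"
proof -
  let ?M = "measure_pmf (replicate_pmf m (pmf_of_set (constraints n :: 'k constraint set)))"
  let ?\<theta> = "(t - d) / 2"
  let ?bad = "\<lambda>J. {xs :: 'k constraint list. real_of_int (surplus ((!) xs) t {} J) < d * card J}"
  let ?I = "\<lambda>j. {J. J \<subseteq> {..<m} \<and> card J = j}"
  have Q0: "Q \<ge> 0" by (simp add: Q_def)
  have finI: "finite (?I j)" for j by (rule finite_subset[of _ "Pow {..<m}"]) auto
  have inner: "measure ?M (\<Union>J\<in>?I j. ?bad J) \<le> Q ^ j" if j: "j \<in> {1..s}" for j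
  proof -
    have "measure ?M (\<Union>J\<in>?I j. ?bad J) \<le> (\<Sum>J\<in>?I j. measure ?M (?bad J))"
      using finI by (intro measure_pmf.finite_measure_subadditive_finite) auto
    also have "\<dots> \<le> (\<Sum>J\<in>?I j. 2 ^ (k * j) * (real (k * j) / n) powr (?\<theta> * j))"
    proof (rule sum_mono)
      fix J assume "J \<in> ?I j"
      thus "measure ?M (?bad J) \<le> 2 ^ (k * j) * (real (k * j) / n) powr (?\<theta> * j)"
        using prob_not_expanding[OF n, of J m d t, where 'k='k] j d by (force simp: k_def)
    qed
    also have "\<dots> = real (m choose j) * (2 ^ (k * j) * (real (k * j) / n) powr (?\<theta> * j))"
      using n_subsets[of "{..<m}" j] by simp
    also have "\<dots> \<le> (exp 1 * m / j) ^ j * (2 ^ (k * j) * (real (k * j) / n) powr (?\<theta> * j))"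
      using j by (intro mult_right_mono binomial_le_exp) auto
    also have "\<dots> = (exp 1 * m / j * (2 ^ k * (real (k * j) / n) powr ?\<theta>)) ^ j"
    proof -
      have "real (k * j) / n > 0" using j n by (simp add: k_def)
      hence "(real (k * j) / n) powr (?\<theta> * j) = ((real (k * j) / n) powr ?\<theta>) ^ j"
        by (subst powr_powr[symmetric]) (intro powr_realpow, simp only: powr_gt_zero)
      thus ?thesis by (simp only: power_mult_distrib power_mult)
    qed
    also have "exp 1 * m / j * (2 ^ k * (real (k * j) / n) powr ?\<theta>) =
        exp 1 * m * 2 ^ k * k powr ?\<theta> * j powr (?\<theta> - 1) * n powr (- ?\<theta>)"
      using j n by (simp add: powr_divide powr_mult powr_diff powr_minus_divide)
    also have "\<dots> ^ j \<le> Q ^ j"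
      unfolding Q_def using j d by (intro power_mono mult_right_mono mult_left_mono powr_mono2) auto
    finally show ?thesis .
  qed
  have "measure ?M {xs. \<exists>J\<subseteq>{..<m}. J \<noteq> {} \<and> card J \<le> s \<and> real_of_int (surplus ((!) xs) t {} J) < d * card J}
      \<le> measure ?M (\<Union>j\<in>{1..s}. \<Union>J\<in>?I j. ?bad J)"
  proof (rule measure_pmf.finite_measure_mono)
    show "{xs. \<exists>J\<subseteq>{..<m}. J \<noteq> {} \<and> card J \<le> s \<and> real_of_int (surplus ((!) xs) t {} J) < d * card J}
      \<subseteq> (\<Union>j\<in>{1..s}. \<Union>J\<in>?I j. ?bad J)"
    proof clarify
      fix xs :: "'k constraint list" and J
      assume J: "J \<subseteq> {..<m}" "J \<noteq> {}" "card J \<le> s" "real_of_int (surplus ((!) xs) t {} J) < d * card J"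
      have "finite J" using J(1) finite_subset by blast
      hence "card J \<ge> 1" using J(2) by (simp add: Suc_le_eq card_gt_0_iff)
      thus "xs \<in> (\<Union>j\<in>{1..s}. \<Union>J\<in>?I j. ?bad J)" using J by auto
    qed
  qed simp
  also have "\<dots> \<le> (\<Sum>j\<in>{1..s}. measure ?M (\<Union>J\<in>?I j. ?bad J))"
    by (intro measure_pmf.finite_measure_subadditive_finite) auto
  also have "\<dots> \<le> (\<Sum>j\<in>{1..s}. Q ^ j)" using inner by (rule sum_mono)
  also have "\<dots> \<le> 2 * Q"
  proof -
    \<comment> \<open>The subtracted term makes the induction go through.\<close>
    have "(\<Sum>j\<in>{1..s}. Q ^ j) \<le> 2 * Q - 2 * Q * Q ^ s"
    proof (induction s)
      case (Suc s)
      have "Q ^ Suc s \<le> 2 * Q * Q ^ s * (1 - Q)"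
        using mult_left_mono[of 1 "2 * (1 - Q)" "Q ^ Suc s"] Q Q0 by (simp add: algebra_simps)
      thus ?case using Suc by (simp add: algebra_simps)
    qed simp
    moreover have "2 * Q * Q ^ s \<ge> 0" using Q0 by simp
    ultimately show ?thesis by linarith
  qed
  finally show ?thesis .
qed

lemma prob_rounds_nonempty_ge:
  fixes \<mu> :: "('k::finite \<Rightarrow> bool) pmf" and d :: real and m n s s0 t :: nat
  assumes u: "uniform_pmf (t - 1) \<mu>" and supp: "set_pmf \<mu> \<subseteq> {z. P z}" and n: "n > 0"
    and d: "d > 0" "d \<le> real t - 2"
    and s0: "d * s0 \<ge> 2" "real s0 \<ge> real s * (1 + CARD('k) / d)" and s: "d * s \<ge> 4 + 4 * real r"
  defines "Q \<equiv> exp 1 * m * 2 ^ CARD('k) * CARD('k) powr ((t - d) / 2) * s0 powr ((t - d) / 2 - 1)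
      * n powr (- ((t - d) / 2))"
  assumes Q: "Q \<le> 1 / 2"
  shows "measure_pmf.prob (random_instance n m) {I. (N_plus n ^^ r) (csp_polytope n P I) \<noteq> {}} \<ge> 1 - 2 * Q"
proof -
  let ?p = "replicate_pmf m (pmf_of_set (constraints n :: 'k constraint set))"
  let ?bad = "{xs :: 'k constraint list. \<exists>J\<subseteq>{..<m}. J \<noteq> {} \<and> card J \<le> s0 \<and> real_of_int (surplus ((!) xs) t {} J) < d * card J}"
  have b: "measure_pmf.prob ?p ?bad \<le> 2 * Q"
    using prob_some_not_expanding[OF n d(2), of m s0, where 'k='k] Q by (simp add: Q_def)
  have "1 - measure_pmf.prob ?p ?bad = measure_pmf.prob ?p (- ?bad)"
    using measure_pmf.prob_compl[of ?bad ?p] by (simp add: Compl_eq_Diff_UNIV)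
  also have "\<dots> \<le> measure_pmf.prob ?p {xs. (N_plus n ^^ r) (csp_polytope n P (mset xs)) \<noteq> {}}"
  proof (rule measure_pmf.finite_measure_mono_AE)
    show "AE xs in ?p. xs \<in> - ?bad \<longrightarrow> xs \<in> {xs. (N_plus n ^^ r) (csp_polytope n P (mset xs)) \<noteq> {}}"
      unfolding AE_measure_pmf_iff
    proof (intro ballI impI)
      fix xs assume xs: "xs \<in> set_pmf ?p" and good: "xs \<in> - ?bad"
      have "set_pmf (pmf_of_set (constraints n)) = (constraints n :: 'k constraint set)"
        using n by (intro set_pmf_of_set constraints_nonempty finite_constraints)
      hence len: "length xs = m" and mem: "\<And>e. e \<in> set xs \<Longrightarrow> e \<in> constraints n"
        using xs by (auto simp: set_replicate_pmf)
      have "snd (xs ! e) q < n" if "e < length xs" for e q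
        using mem[OF nth_mem[OF that]] by (auto simp: constraints_def)
      moreover have "real_of_int (surplus ((!) xs) t {} A) \<ge> d * card A"
        if A: "A \<subseteq> {..<length xs}" "card A \<le> s0" for A
        using good A len by (cases "A = {}") (auto simp: not_less)
      ultimately have "(N_plus n ^^ r) (csp_polytope n P (mset xs)) \<noteq> {}"
        by (intro rounds_nonempty_of_expansion[OF u supp _ d(1) _ s0 s]) auto
      thus "xs \<in> {xs. (N_plus n ^^ r) (csp_polytope n P (mset xs)) \<noteq> {}}" by simp
    qed
  qed simp
  also have "\<dots> = measure_pmf.prob (random_instance n m) {I. (N_plus n ^^ r) (csp_polytope n P I) \<noteq> {}}"
    by (simp add: random_instance_def vimage_def)
  finally show ?thesis using b by linarith
qed

theorem theorem1p4:
  fixes P :: "('k::finite \<Rightarrow> bool) \<Rightarrow> bool"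
    and t :: nat
    and \<epsilon> :: real
  assumes "t \<ge> 3"
    and "\<epsilon> > 0"
    and "uniform_supporting (t - 1) P"
  shows "\<exists>r :: nat \<Rightarrow> nat.
    (\<lambda>n. real (r n)) \<in> \<Omega>(\<lambda>n. real n powr (\<epsilon> / (real t - 2))) \<and>
    (\<forall>m :: nat \<Rightarrow> nat. (\<forall>n. real (m n) \<le> real n powr (real t / 2 - \<epsilon>)) \<longrightarrow>
      (\<lambda>n. measure_pmf.prob (random_instance n (m n))
             {I. (N_plus n ^^ r n) (csp_polytope n P I) \<noteq> {}}) \<longlonglongrightarrow> 1)"
proof -
  obtain \<mu> :: "('k \<Rightarrow> bool) pmf" where supp: "set_pmf \<mu> \<subseteq> {z. P z}" and u: "uniform_pmf (t - 1) \<mu>"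
    using assms(3) by (auto simp: uniform_supporting_def uniform_pmf_def)
  define k where "k = CARD('k)"
  define \<gamma> where "\<gamma> = \<epsilon> / (real t - 2)"
  \<comment> \<open>\<open>d \<le> \<epsilon>\<close> makes \<open>\<eta>\<close> positive, and
    \<open>d \<le> 1 / 2\<close> gives \<open>d \<le> t - 2\<close>, hence
    \<open>\<theta> \<ge> 1\<close>.\<close>
  define d where "d = min \<epsilon> (1 / 2)"
  define \<theta> where "\<theta> = (real t - d) / 2"
  define r where "r n = nat \<lfloor>real n powr \<gamma>\<rfloor>" for n :: nat
  \<comment> \<open>Both sizes are the least that meet the requirements of the deterministic part
    for \<open>r n\<close> rounds; \<open>c\<close> below is the constant with
    \<open>s0 n \<le> c * n powr \<gamma>\<close>.\<close>
  define s where "s n = nat \<lceil>(4 + 4 * real (r n)) / d\<rceil>" for n :: nat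
  define s0 where "s0 n = nat \<lceil>real (s n) * (1 + k / d) + 2 / d\<rceil>" for n :: nat
  define c where "c = (8 / d + 1) * (1 + k / d) + 2 / d + 1"
  define \<eta> where "\<eta> = (\<epsilon> - d) / 2 + \<gamma> * d / 2"
  define A where "A = exp 1 * 2 ^ k * k powr \<theta> * c powr (\<theta> - 1)"
  have t2: "real t - 2 \<ge> 1" using assms(1) by simp
  have d: "d > 0" "d \<le> 1 / 2" "d \<le> \<epsilon>" using assms(2) by (auto simp: d_def)
  have \<gamma>: "\<gamma> > 0" using assms(2) t2 by (simp add: \<gamma>_def)
  have \<theta>: "\<theta> \<ge> 1" using t2 d by (simp add: \<theta>_def)
  have \<eta>: "\<eta> > 0" using d \<gamma> by (simp add: \<eta>_def add_nonneg_pos)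
  have c: "c > 0" using d by (simp add: c_def add_nonneg_pos)
  have r_le: "real (r n) \<le> n powr \<gamma>" for n by (simp add: r_def)
  have n1: "real n powr \<gamma> \<ge> 1" if "n > 0" for n :: nat
    using that \<gamma> by (intro ge_one_powr_ge_zero) auto
  have s_ge: "d * s n \<ge> 4 + 4 * real (r n)" for n
  proof -
    have "(4 + 4 * real (r n)) / d \<le> s n" unfolding s_def by linarith
    thus ?thesis using d by (simp add: field_simps)
  qed
  have s0_ge: "real (s0 n) \<ge> real (s n) * (1 + k / d) + 2 / d" for n unfolding s0_def by linarith
  have s0_ge1: "d * s0 n \<ge> 2" for n
  proof -
    have "real (s n) * (1 + k / d) \<ge> 0" using d by simp
    hence "real (s0 n) \<ge> 2 / d" using s0_ge[of n] by linarith
    thus ?thesis using d by (simp add: field_simps)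
  qed
  have s0_ge2: "real (s0 n) \<ge> real (s n) * (1 + k / d)" for n
    using s0_ge[of n] d by (smt (verit) divide_nonneg_pos)
  have s0_le: "real (s0 n) \<le> c * n powr \<gamma>" if "n > 0" for n
  proof -
    let ?y = "real n powr \<gamma>"
    have "(4 + 4 * real (r n)) / d \<ge> 0" using d by simp
    hence "real (s n) \<le> (4 + 4 * real (r n)) / d + 1" unfolding s_def by linarith
    also have "\<dots> \<le> (4 * ?y + 4 * ?y) / d + ?y"
      using n1[OF that] r_le[of n] d by (intro add_mono divide_right_mono) auto
    also have "\<dots> = (8 / d + 1) * ?y" using d by (simp add: field_simps)
    finally have "real (s n) * (1 + k / d) \<le> (8 / d + 1) * ?y * (1 + k / d)"
      using d by (intro mult_right_mono) auto
    moreover have "2 / d + 1 \<le> (2 / d + 1) * ?y"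
      using mult_left_mono[OF n1[OF that], of "2 / d + 1"] d by simp
    moreover have "real (s0 n) \<le> real (s n) * (1 + k / d) + 2 / d + 1"
    proof -
      have "real (s n) * (1 + k / d) + 2 / d \<ge> 0" using d by simp
      thus ?thesis unfolding s0_def by linarith
    qed
    ultimately have "real (s0 n) \<le> (8 / d + 1) * ?y * (1 + k / d) + (2 / d + 1) * ?y" by linarith
    also have "\<dots> = c * ?y" by (simp add: c_def algebra_simps)
    finally show ?thesis .
  qed
  have "(\<lambda>n. real (r n)) \<in> \<Omega>(\<lambda>n. real n powr \<gamma>)"
  proof (rule landau_omega.bigI[of "1 / 2"])
    show "\<forall>\<^sub>F n in sequentially. norm (real (r n)) \<ge> 1 / 2 * norm (real n powr \<gamma>)"
    proof (rule eventually_mono[OF eventually_gt_at_top[of 0]])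
      fix n :: nat assume "0 < n"
      from n1[OF this] have "\<lfloor>real n powr \<gamma>\<rfloor> \<ge> 1" by simp
      hence "real (r n) \<ge> 1" by (simp add: r_def nat_le_iff le_nat_iff)
      moreover have "real (r n) \<ge> n powr \<gamma> - 1" unfolding r_def by linarith
      \<comment> \<open>Adding the two lower bounds gives
        \<open>2 * r n \<ge> n powr \<gamma>\<close>.\<close>
      ultimately
      show "norm (real (r n)) \<ge> 1 / 2 * norm (real n powr \<gamma>)" by simp
    qed
  qed simp
  moreover have "(\<lambda>n. measure_pmf.prob (random_instance n (m n))
             {I. (N_plus n ^^ r n) (csp_polytope n P I) \<noteq> {}}) \<longlonglongrightarrow> 1"
    if m: "\<forall>n. real (m n) \<le> real n powr (real t / 2 - \<epsilon>)" for m :: "nat \<Rightarrow> nat"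
  proof -
    define Q where "Q n = exp 1 * m n * 2 ^ k * k powr \<theta> * s0 n powr (\<theta> - 1) * n powr (- \<theta>)" for n :: nat
    have Q_le: "Q n \<le> A * n powr (- \<eta>)" if n: "n > 0" for n
    proof -
      have "Q n \<le> exp 1 * n powr (t / 2 - \<epsilon>) * 2 ^ k * k powr \<theta> * (c * n powr \<gamma>) powr (\<theta> - 1) * n powr (- \<theta>)"
        unfolding Q_def using m s0_le[OF n] \<theta>
        by (intro mult_right_mono mult_mono powr_mono2) auto
      also have "\<dots> = A * (n powr (t / 2 - \<epsilon>) * n powr (\<gamma> * (\<theta> - 1)) * n powr (- \<theta>))"
        using c n by (simp add: A_def powr_mult powr_powr)
      also have "n powr (t / 2 - \<epsilon>) * n powr (\<gamma> * (\<theta> - 1)) * n powr (- \<theta>) = n powr (t / 2 - \<epsilon> + \<gamma> * (\<theta> - 1) + - \<theta>)"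
        by (simp only: powr_add)
      \<comment> \<open>Here the rate \<open>\<gamma> = \<epsilon> / (t - 2)\<close> is decisive:
        the growth of \<open>s0\<close> costs \<open>\<epsilon> / 2 - \<gamma> d / 2\<close>, and
        the term \<open>\<gamma> d / 2\<close> keeps \<open>\<eta>\<close> positive even for
        \<open>d = \<epsilon>\<close>.\<close>
      also have "t / 2 - \<epsilon> + \<gamma> * (\<theta> - 1) + - \<theta> = - \<eta>"
      proof -
        have "\<gamma> * (real t - 2) = \<epsilon>" using t2 by (simp add: \<gamma>_def)
        moreover have "\<gamma> * (\<theta> - 1) = \<gamma> * (real t - 2) / 2 - \<gamma> * d / 2" by (simp add: \<theta>_def field_simps)
        ultimately show ?thesis by (simp add: \<eta>_def \<theta>_def field_simps)
      qed
      finally show ?thesis .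
    qed
    have lim0: "(\<lambda>n. A * real n powr (- \<eta>)) \<longlonglongrightarrow> 0"
      using \<eta> by (intro tendsto_mult_right_zero tendsto_neg_powr filterlim_real_sequentially) auto
    have ev: "\<forall>\<^sub>F n in sequentially. A * real n powr (- \<eta>) < 1 / 2"
      using lim0 by (rule order_tendstoD) simp
    have low: "\<forall>\<^sub>F n in sequentially. 1 - 2 * (A * real n powr (- \<eta>)) \<le>
        measure_pmf.prob (random_instance n (m n)) {I. (N_plus n ^^ r n) (csp_polytope n P I) \<noteq> {}}"
      using ev eventually_gt_at_top[of 0]
    proof eventually_elim
      case (elim n)
      have "Q n \<le> 1 / 2" using Q_le[OF elim(2)] elim(1) by linarith
      hence "1 - 2 * Q n \<le> measure_pmf.prob (random_instance n (m n))
          {I. (N_plus n ^^ r n) (csp_polytope n P I) \<noteq> {}}"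
        using prob_rounds_nonempty_ge[OF u supp elim(2) d(1) _ s0_ge1 _ s_ge, of n n "m n"] s0_ge2[of n] t2 d
        by (simp add: Q_def k_def \<theta>_def)
      thus ?case using Q_le[OF elim(2)] by linarith
    qed
    show ?thesis
    proof (rule tendsto_sandwich[OF low])
      show "\<forall>\<^sub>F n in sequentially. measure_pmf.prob (random_instance n (m n))
          {I. (N_plus n ^^ r n) (csp_polytope n P I) \<noteq> {}} \<le> 1" by simp
      show "(\<lambda>n. 1 - 2 * (A * real n powr (- \<eta>))) \<longlonglongrightarrow> 1"
        using tendsto_diff[OF tendsto_const tendsto_mult_right_zero[OF lim0, of 2], of 1] by simp
    qed simp
  qed
  ultimately show ?thesis unfolding \<gamma>_def by blast
qed

end
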